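(* Let $\mathbf{P}$ be an operad with $\mathbf{P}(0)=(0)$ and all $\mathbf{P}(n)$ finite-dimensional. The following map (the algebra morphism given on generators as indicated) is a bialgebra isomorphism: $$\psi_{\mathbf{P}}:\left\{\begin{array}{rcl}D^*_{\mathbf{P}}=(S(\mathbf{P}^* ),m,\Delta_* )&\longrightarrow&D'_{\mathbf{P}}=(S(\mathbf{P}^* ),m,\Delta'_* )\\ f\in\mathbf{P}_0^*&\longmapsto&f-\varepsilon_0(f)1,\\ f\in\mathbf{P}_+^*&\longmapsto&f.\end{array}\right.$$
   Context: $K$ is a field of characteristic zero, $\mathbf{P}=\bigoplus_{n\ge1}\mathbf{P}(n)$ is graded with the elements of $\mathbf{P}(n)$ homogeneous of degree $n-1$, so $\mathbf{P}_0=\mathbf{P}(1)$ is the degree $0$ component; $\mathbf{P}^*=\bigoplus_{n\ge1}\mathbf{P}(n)^*$, $\mathbf{P}_+^*=\bigoplus_{n\ge2}\mathbf{P}(n)^*$, and $m$ is the usual product of $S(\mathbf{P}^* )$. $I\in\mathbf{P}(1)$ is the unit of the operad, and $\varepsilon_0(f)=f(I)$ for $f\in\mathbf{P}_0^*$. The coproducts on $S(\mathbf{P}^* )$ are induced, by abelianization, from the following coproducts on $T(\mathbf{P}^* )$, both of which are algebra morphisms for concatenation and make $T(\mathbf{P}^* )$ a bialgebra. $\Delta_*$: for $f\in\mathbf{P}^*$, $\Delta_*(f)\in\mathbf{P}^*\otimes T(\mathbf{P}^* )$ is the transpose of the operadic composition, $\Delta_*(f)(q\otimes q_1\cdots q_p)=f(q\circ(q_1,\ldots,q_p))$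 for $q\in\mathbf{P}(p)$, $q_i\in\mathbf{P}$, its component in $\mathbf{P}(p)^*\otimes(\mathbf{P}^* )^{\otimes r}$ being $0$ for $r\ne p$. $\Delta'_*$: for $f\in\mathbf{P}^*$, $\ll\Delta'_*(f),X\otimes Y\gg'=f(\langle X,Y\rangle)$ for $X,Y\in T(\mathbf{P})$, where $\ll f_1\cdots f_k,x_1\cdots x_l\gg'=\delta_{k,l}f_1(x_1)\cdots f_k(x_k)$ and $\langle p,p_1\cdots p_k\rangle=\sum_{1\le i_1<\cdots<i_k\le n}p\circ_{i_1,\ldots,i_k}(p_1,\ldots,p_k)$ for $p\in\mathbf{P}(n)$ (composition with $p_l$ in position $i_l$ and $I$ elsewhere; $\langle p,1\rangle=p$), $\langle1,x\rangle=x$ for $x\in\mathbf{P}$, $\langle1,v\rangle=0$ for $v\in\mathbf{P}^{\otimes l}$, $l\ne1$, and $\langle u,v\rangle=0$ for $u\in\mathbf{P}^{\otimes k}$, $k\ge2$.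
   Formalization: The printed map fails already for P = K·I; what is proved is that f ↦ f + ε₀(f)1 on P₀*, f ↦ f on P₊* gives a bialgebra isomorphism D* → D', and that the printed formula f ↦ f − ε₀(f)1 gives one in the opposite direction, D' → D*. *)

theory Defs
  imports
    Complex_Main
    "HOL-Library.Multiset"
    "HOL-Library.Poly_Mapping"
    "HOL-Library.Product_Plus"
    "HOL-Library.Function_Algebras"
begin

section \<open>Operads\<close>

text \<open>
  The type \<open>'p\<close> is the whole space \<open>P = (\<Oplus>n. P(n))\<close>, with \<open>ops P n\<close> the subspace \<open>P(n)\<close>.
  The full composition \<open>q \<circ> (q\<^sub>1,\<dots>,q\<^sub>n)\<close> is \<open>opcomp P q [q\<^sub>1,\<dots>,q\<^sub>n]\<close>; it is meaningful for
  \<open>q \<in> P(n)\<close> and arbitrary \<open>q\<^sub>i \<in> P\<close>. Symmetric group actions do not enter into the coproducts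
  below, so none is required: symmetric operads and nonsymmetric ones are both covered.
\<close>

record ('k, 'p) operad_data =
  smul :: "'k \<Rightarrow> 'p \<Rightarrow> 'p"
  ops :: "nat \<Rightarrow> 'p set"
  opcomp :: "'p \<Rightarrow> 'p list \<Rightarrow> 'p"
  opunit :: "'p"

locale operad =
  fixes P :: "('k::field, 'p::ab_group_add) operad_data"
  assumes vector_space: "vector_space (smul P)"
    and subspace_ops: "module.subspace (smul P) (ops P n)"
    and direct_sum:
      "\<exists>!c. (\<forall>n. c n \<in> ops P n) \<and> finite {n. c n \<noteq> 0} \<and> x = (\<Sum>n | c n \<noteq> 0. c n)"
    and opunit_in: "opunit P \<in> ops P 1"
    and opcomp_in:
      "\<lbrakk>q \<in> ops P (length qs); length ks = length qs; \<forall>i < length qs. qs ! i \<in> ops P (ks ! i)\<rbrakk>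
        \<Longrightarrow> opcomp P q qs \<in> ops P (sum_list ks)"
    and opcomp_add_left:
      "\<lbrakk>q \<in> ops P (length qs); q' \<in> ops P (length qs)\<rbrakk>
        \<Longrightarrow> opcomp P (q + q') qs = opcomp P q qs + opcomp P q' qs"
    and opcomp_smul_left:
      "q \<in> ops P (length qs) \<Longrightarrow> opcomp P (smul P c q) qs = smul P c (opcomp P q qs)"
    and opcomp_add_right:
      "q \<in> ops P (length as + Suc (length bs))
        \<Longrightarrow> opcomp P q (as @ (x + y) # bs) = opcomp P q (as @ x # bs) + opcomp P q (as @ y # bs)"
    and opcomp_smul_right:
      "q \<in> ops P (length as + Suc (length bs))
        \<Longrightarrow> opcomp P q (as @ smul P c x # bs) = smul P c (opcomp P q (as @ x # bs))"
    and opcomp_unit_left: "opcomp P (opunit P) [x] = x"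
    and opcomp_unit_right: "q \<in> ops P n \<Longrightarrow> opcomp P q (replicate n (opunit P)) = q"
    and opcomp_assoc:
      "\<lbrakk>q \<in> ops P (length qs); length rss = length qs;
        \<forall>i < length qs. qs ! i \<in> ops P (length (rss ! i))\<rbrakk>
        \<Longrightarrow> opcomp P (opcomp P q qs) (concat rss) = opcomp P q (map2 (opcomp P) qs rss)"

text \<open>The graded dual \<open>P\<^sup>* = (\<Oplus>n. P(n)\<^sup>*)\<close>, and its part \<open>(\<Oplus>n\<in>N. P(n)\<^sup>*)\<close>.\<close>

definition dual :: "('k::field, 'p::ab_group_add) operad_data \<Rightarrow> ('p \<Rightarrow> 'k) set" where
  "dual P = {f. Vector_Spaces.linear (smul P) (*) f \<and> finite {n. \<exists>x\<in>ops P n. f x \<noteq> 0}}"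

definition dual_on :: "('k::field, 'p::ab_group_add) operad_data \<Rightarrow> nat set \<Rightarrow> ('p \<Rightarrow> 'k) set" where
  "dual_on P N = {f \<in> dual P. \<forall>n. n \<notin> N \<longrightarrow> (\<forall>x\<in>ops P n. f x = 0)}"

definition fscale :: "'k::times \<Rightarrow> ('a \<Rightarrow> 'k) \<Rightarrow> 'a \<Rightarrow> 'k" where
  "fscale c f = (\<lambda>x. c * f x)"

interpretation fn: vector_space "fscale :: 'k::field \<Rightarrow> ('a \<Rightarrow> 'k) \<Rightarrow> 'a \<Rightarrow> 'k"
  by unfold_locales (auto simp: fscale_def fun_eq_iff algebra_simps)


section \<open>Monoid algebras and bialgebras\<close>

text \<open>
  For a submonoid \<open>M\<close> of \<open>'m\<close>, \<open>lincomb M\<close> is the space with basis \<open>M\<close>; with the convolution product of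
  \<^typ>\<open>'m \<Rightarrow>\<^sub>0 'k\<close> it is the monoid algebra \<open>K[M]\<close>. Tensor products are formed on bases:
  \<open>K[M] \<otimes> K[N]\<close> is \<open>K[M \<times> N]\<close>, the pair \<open>(m, n)\<close> standing for \<open>m \<otimes> n\<close>. The product of
  \<^typ>\<open>'m \<times> 'n \<Rightarrow>\<^sub>0 'k\<close> is then \<open>(m \<otimes> n)(m' \<otimes> n') = mm' \<otimes> nn'\<close>. The scalar \<open>c\<close> is \<open>single 0 c\<close>.
\<close>

definition lincomb :: "'m set \<Rightarrow> ('m \<Rightarrow>\<^sub>0 'k::zero) set" where
  "lincomb M = {u. Poly_Mapping.keys u \<subseteq> M}"

definition alg_hom ::
    "'m set \<Rightarrow> 'n set \<Rightarrow> (('m::comm_monoid_add \<Rightarrow>\<^sub>0 'k::field) \<Rightarrow> ('n::comm_monoid_add \<Rightarrow>\<^sub>0 'k)) \<Rightarrow> bool"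
  where
  "alg_hom M N h \<longleftrightarrow>
    (\<forall>u\<in>lincomb M. h u \<in> lincomb N) \<and>
    (\<forall>u\<in>lincomb M. \<forall>v\<in>lincomb M. h (u + v) = h u + h v \<and> h (u * v) = h u * h v) \<and>
    (\<forall>c. h (Poly_Mapping.single 0 c) = Poly_Mapping.single 0 c)"

definition character :: "'m set \<Rightarrow> (('m::comm_monoid_add \<Rightarrow>\<^sub>0 'k::field) \<Rightarrow> 'k) \<Rightarrow> bool" where
  "character M e \<longleftrightarrow>
    (\<forall>u\<in>lincomb M. \<forall>v\<in>lincomb M. e (u + v) = e u + e v \<and> e (u * v) = e u * e v) \<and>
    (\<forall>c. e (Poly_Mapping.single 0 c) = c)"

definition tensor :: "('m \<Rightarrow>\<^sub>0 'k::comm_semiring_0) \<Rightarrow> ('n \<Rightarrow>\<^sub>0 'k) \<Rightarrow> ('m \<times> 'n \<Rightarrow>\<^sub>0 'k)" where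
  "tensor u v = (\<Sum>m\<in>Poly_Mapping.keys u. \<Sum>n\<in>Poly_Mapping.keys v. Poly_Mapping.single (m, n) (Poly_Mapping.lookup u m * Poly_Mapping.lookup v n))"

definition tensor_map ::
    "(('m \<Rightarrow>\<^sub>0 'k) \<Rightarrow> ('a::comm_monoid_add \<Rightarrow>\<^sub>0 'k)) \<Rightarrow> (('n \<Rightarrow>\<^sub>0 'k) \<Rightarrow> ('b::comm_monoid_add \<Rightarrow>\<^sub>0 'k))
      \<Rightarrow> ('m \<times> 'n \<Rightarrow>\<^sub>0 'k::field) \<Rightarrow> ('a \<times> 'b \<Rightarrow>\<^sub>0 'k)" where
  "tensor_map g h w =
    (\<Sum>(m, n)\<in>Poly_Mapping.keys w. Poly_Mapping.single 0 (Poly_Mapping.lookup w (m, n)) * tensor (g (Poly_Mapping.single m 1)) (h (Poly_Mapping.single n 1)))"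

definition reassoc :: "(('a \<times> 'b) \<times> 'c \<Rightarrow>\<^sub>0 'k::comm_monoid_add) \<Rightarrow> ('a \<times> 'b \<times> 'c \<Rightarrow>\<^sub>0 'k)" where
  "reassoc w = (\<Sum>((a, b), c)\<in>Poly_Mapping.keys w. Poly_Mapping.single (a, b, c) (Poly_Mapping.lookup w ((a, b), c)))"

record (overloaded) ('m, 'k) bialgebra_data =
  mons :: "'m set"
  comult :: "('m \<Rightarrow>\<^sub>0 'k) \<Rightarrow> ('m \<times> 'm \<Rightarrow>\<^sub>0 'k)"
  counit :: "('m \<Rightarrow>\<^sub>0 'k) \<Rightarrow> 'k"

definition bialgebra :: "('m::comm_monoid_add, 'k::field) bialgebra_data \<Rightarrow> bool" where
  "bialgebra A \<longleftrightarrow>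
    0 \<in> mons A \<and> (\<forall>m\<in>mons A. \<forall>n\<in>mons A. m + n \<in> mons A) \<and>
    alg_hom (mons A) (mons A \<times> mons A) (comult A) \<and>
    character (mons A) (counit A) \<and>
    (\<forall>u\<in>lincomb (mons A).
      reassoc (tensor_map (comult A) id (comult A u)) = tensor_map id (comult A) (comult A u) \<and>
      (\<Sum>(m, n)\<in>Poly_Mapping.keys (comult A u). Poly_Mapping.single n (Poly_Mapping.lookup (comult A u) (m, n) * counit A (Poly_Mapping.single m 1))) = u \<and>
      (\<Sum>(m, n)\<in>Poly_Mapping.keys (comult A u). Poly_Mapping.single m (Poly_Mapping.lookup (comult A u) (m, n) * counit A (Poly_Mapping.single n 1))) = u)"

definition bialgebra_iso ::
    "('m::comm_monoid_add, 'k::field) bialgebra_data \<Rightarrow> ('n::comm_monoid_add, 'k) bialgebra_data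
      \<Rightarrow> (('m \<Rightarrow>\<^sub>0 'k) \<Rightarrow> ('n \<Rightarrow>\<^sub>0 'k)) \<Rightarrow> bool" where
  "bialgebra_iso A B h \<longleftrightarrow>
    bialgebra A \<and> bialgebra B \<and>
    alg_hom (mons A) (mons B) h \<and>
    bij_betw h (lincomb (mons A)) (lincomb (mons B)) \<and>
    (\<forall>u\<in>lincomb (mons A).
      comult B (h u) = tensor_map h h (comult A u) \<and> counit B (h u) = counit A u)"


section \<open>The symmetric algebra of the graded dual\<close>

text \<open>
  \<open>S(P\<^sup>*)\<close> is the polynomial algebra on a basis of \<open>P\<^sup>*\<close>: monomials are finite multisets of basis
  elements. The canonical map \<open>P\<^sup>* \<rightarrow> S(P\<^sup>*)\<close> is \<open>gen P\<close>. Lemma \<open>S_universal\<close> below is the universal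
  property, by which the choice of the basis is immaterial.
\<close>

definition dual_basis :: "('k::field, 'p::ab_group_add) operad_data \<Rightarrow> ('p \<Rightarrow> 'k) set" where
  "dual_basis P = (SOME B. B \<subseteq> dual P \<and> fn.independent B \<and> fn.span B = dual P)"

lemma subspace_dual:
  fixes P :: "('k::field, 'p::ab_group_add) operad_data"
  assumes "operad P"
  shows "fn.subspace (dual P)"
proof -
  interpret V: vector_space "smul P" using assms by (rule operad.vector_space)
  have K: "vector_space ((*) :: 'k \<Rightarrow> 'k \<Rightarrow> 'k)"
    by unfold_locales (auto simp: algebra_simps)
  interpret VK: vector_space_pair "smul P" "(*) :: 'k \<Rightarrow> 'k \<Rightarrow> 'k"
    by (intro vector_space_pair.intro V.vector_space_axioms K)
  show ?thesis
  proof (rule fn.subspaceI)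
    show "0 \<in> dual P"
      by (simp add: dual_def zero_fun_def VK.linear_zero)
  next
    fix f g assume f: "f \<in> dual P" and g: "g \<in> dual P"
    have "{n. \<exists>x\<in>ops P n. (f + g) x \<noteq> 0}
        \<subseteq> {n. \<exists>x\<in>ops P n. f x \<noteq> 0} \<union> {n. \<exists>x\<in>ops P n. g x \<noteq> 0}"
      by auto
    with f g show "f + g \<in> dual P"
      unfolding dual_def plus_fun_def mem_Collect_eq
      by (intro conjI VK.linear_compose_add) (auto intro: finite_subset)
  next
    fix c f assume f: "f \<in> dual P"
    have "{n. \<exists>x\<in>ops P n. fscale c f x \<noteq> 0} \<subseteq> {n. \<exists>x\<in>ops P n. f x \<noteq> 0}"
      by (auto simp: fscale_def)
    with f show "fscale c f \<in> dual P"
      unfolding dual_def fscale_def mem_Collect_eq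
      by (intro conjI VK.linear_compose_scale_right) (auto intro: finite_subset)
  qed
qed

lemma dual_basis:
  fixes P :: "('k::field, 'p::ab_group_add) operad_data"
  assumes "operad P"
  shows "dual_basis P \<subseteq> dual P" "fn.independent (dual_basis P)" "fn.span (dual_basis P) = dual P"
proof -
  obtain B where B: "B \<subseteq> dual P" "fn.independent B" "dual P \<subseteq> fn.span B"
    by (rule fn.maximal_independent_subset)
  moreover have "fn.span B \<subseteq> dual P"
    using B(1) subspace_dual[OF assms] by (rule fn.span_minimal)
  ultimately have "\<exists>B. B \<subseteq> dual P \<and> fn.independent B \<and> fn.span B = dual P" by blast
  from someI_ex[OF this, folded dual_basis_def]
  show "dual_basis P \<subseteq> dual P" "fn.independent (dual_basis P)" "fn.span (dual_basis P) = dual P"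
    by auto
qed

definition S_mons :: "('k::field, 'p::ab_group_add) operad_data \<Rightarrow> ('p \<Rightarrow> 'k) multiset set" where
  "S_mons P = {m. set_mset m \<subseteq> dual_basis P}"

definition gen ::
    "('k::field, 'p::ab_group_add) operad_data \<Rightarrow> ('p \<Rightarrow> 'k) \<Rightarrow> (('p \<Rightarrow> 'k) multiset \<Rightarrow>\<^sub>0 'k)" where
  "gen P f = (\<Sum>b | fn.representation (dual_basis P) f b \<noteq> 0.
      Poly_Mapping.single {#b#} (fn.representation (dual_basis P) f b))"

text \<open>The algebra morphism with prescribed values \<open>g\<close> on the variables, into an algebra whose
  scalars are embedded by \<open>\<kappa>\<close>.\<close>

definition alg_ext :: "('k \<Rightarrow> 'a) \<Rightarrow> ('b \<Rightarrow> 'a) \<Rightarrow> ('b multiset \<Rightarrow>\<^sub>0 'k::zero) \<Rightarrow> 'a::comm_ring_1" where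
  "alg_ext \<kappa> g u = (\<Sum>m\<in>Poly_Mapping.keys u. \<kappa> (Poly_Mapping.lookup u m) * (\<Prod>b\<in>#m. g b))"

lemma alg_ext_superset:
  assumes "finite A" "Poly_Mapping.keys u \<subseteq> A" "\<kappa> 0 = 0"
  shows "alg_ext \<kappa> g u = (\<Sum>m\<in>A. \<kappa> (Poly_Mapping.lookup u m) * (\<Prod>b\<in>#m. g b))"
  unfolding alg_ext_def using assms
  by (intro sum.mono_neutral_left) (auto simp: in_keys_iff)

lemma alg_ext_add:
  assumes "\<kappa> 0 = 0" "\<And>c d. \<kappa> (c + d) = \<kappa> c + \<kappa> d"
  shows "alg_ext \<kappa> g (u + v) = alg_ext \<kappa> g u + alg_ext \<kappa> g v"
proof -
  let ?A = "Poly_Mapping.keys u \<union> Poly_Mapping.keys v"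
  have "Poly_Mapping.keys (u + v) \<subseteq> ?A" by (rule keys_add)
  then show ?thesis
    using assms
    by (simp add: alg_ext_superset[where A = ?A] lookup_add distrib_right sum.distrib)
qed

lemma alg_ext_single:
  assumes "\<kappa> 0 = 0"
  shows "alg_ext \<kappa> g (Poly_Mapping.single m c) = \<kappa> c * (\<Prod>b\<in>#m. g b)"
  using assms by (simp add: alg_ext_superset[where A = "{m}"])

lemma poly_mapping_eq_sum_single:
  "u = (\<Sum>m\<in>Poly_Mapping.keys u. Poly_Mapping.single m (Poly_Mapping.lookup u m))"
  by (rule poly_mapping_eqI)
    (auto simp: lookup_sum lookup_single when_def in_keys_iff)

lemma alg_ext_sum:
  assumes "\<kappa> 0 = 0" "\<And>c d. \<kappa> (c + d) = \<kappa> c + \<kappa> d"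
  shows "alg_ext \<kappa> g (sum f A) = (\<Sum>a\<in>A. alg_ext \<kappa> g (f a))"
proof (induction A rule: infinite_finite_induct)
  case (insert a A)
  then show ?case by (simp add: alg_ext_add[of \<kappa>, OF assms])
qed (simp_all add: alg_ext_def)

lemma alg_ext_mult:
  assumes "\<kappa> 0 = 0" "\<And>c d. \<kappa> (c + d) = \<kappa> c + \<kappa> d" "\<And>c d. \<kappa> (c * d) = \<kappa> c * \<kappa> d"
  shows "alg_ext \<kappa> g (u * v) = alg_ext \<kappa> g u * alg_ext \<kappa> g v"
proof -
  let ?s = "\<lambda>w m. Poly_Mapping.single m (Poly_Mapping.lookup w m)"
  have "u * v = (\<Sum>m\<in>Poly_Mapping.keys u. ?s u m) * (\<Sum>n\<in>Poly_Mapping.keys v. ?s v n)"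
    using poly_mapping_eq_sum_single[of u] poly_mapping_eq_sum_single[of v] by simp
  also have "\<dots> = (\<Sum>m\<in>Poly_Mapping.keys u. \<Sum>n\<in>Poly_Mapping.keys v. ?s u m * ?s v n)"
    by (rule sum_product)
  finally have *: "u * v = (\<Sum>m\<in>Poly_Mapping.keys u. \<Sum>n\<in>Poly_Mapping.keys v. ?s u m * ?s v n)" .
  show ?thesis
    unfolding * alg_ext_sum[of \<kappa>, OF assms(1,2)]
    unfolding alg_ext_def[of \<kappa> g u] alg_ext_def[of \<kappa> g v] sum_product
    by (intro sum.cong refl)
      (simp add: mult_single alg_ext_single assms mult_ac)
qed

lemma S_universal:
  fixes P :: "('k::field, 'p::ab_group_add) operad_data"
    and \<kappa> :: "'k \<Rightarrow> 'a::comm_ring_1" and g :: "('p \<Rightarrow> 'k) \<Rightarrow> 'a"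
  assumes P: "operad P"
    and \<kappa>: "\<kappa> 1 = 1" "\<And>c d. \<kappa> (c + d) = \<kappa> c + \<kappa> d" "\<And>c d. \<kappa> (c * d) = \<kappa> c * \<kappa> d"
    and g: "\<And>f f'. \<lbrakk>f \<in> dual P; f' \<in> dual P\<rbrakk> \<Longrightarrow> g (f + f') = g f + g f'"
      "\<And>c f. f \<in> dual P \<Longrightarrow> g (fscale c f) = \<kappa> c * g f"
  defines "is_ext \<equiv> \<lambda>h.
      (\<forall>u\<in>lincomb (S_mons P). \<forall>v\<in>lincomb (S_mons P). h (u + v) = h u + h v \<and> h (u * v) = h u * h v) \<and>
      (\<forall>c. h (Poly_Mapping.single 0 c) = \<kappa> c) \<and>
      (\<forall>f\<in>dual P. h (gen P f) = g f)"
  shows "\<exists>h. is_ext h"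
    and "\<lbrakk>is_ext h; is_ext h'; u \<in> lincomb (S_mons P)\<rbrakk> \<Longrightarrow> h u = h' u"
proof -
  let ?B = "dual_basis P"
  have \<kappa>0: "\<kappa> 0 = 0" using \<kappa>(2)[of 0 0] by simp
  have g0: "g 0 = 0"
    using g(2)[OF fn.subspace_0[OF subspace_dual[OF P]], of 0]
    by (simp only: fn.scale_zero_left \<kappa>0 mult_zero_left)
  have g_sum: "g (sum F A) = (\<Sum>a\<in>A. g (F a))" if "\<And>a. a \<in> A \<Longrightarrow> F a \<in> dual P" for F A
    using that
  proof (induction A rule: infinite_finite_induct)
    case (insert a A)
    have "g (F a + sum F A) = g (F a) + g (sum F A)"
      using insert.prems by (intro g(1) fn.subspace_sum[OF subspace_dual[OF P]]) auto
    moreover have "g (sum F A) = (\<Sum>a\<in>A. g (F a))"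
      using insert.prems by (intro insert.IH) auto
    ultimately show ?case by (simp only: sum.insert[OF insert.hyps])
  qed (simp_all only: sum.infinite sum.empty g0 not_False_eq_True)
  have "is_ext (alg_ext \<kappa> g)"
    unfolding is_ext_def
  proof (intro conjI ballI allI)
    fix f assume f: "f \<in> dual P"
    let ?r = "fn.representation ?B f"
    have in_B: "b \<in> dual P" if "?r b \<noteq> 0" for b
      using fn.representation_ne_zero[OF that] dual_basis(1)[OF P] by blast
    have "alg_ext \<kappa> g (gen P f) = (\<Sum>b | ?r b \<noteq> 0. \<kappa> (?r b) * g b)"
      unfolding gen_def by (simp add: alg_ext_sum[of \<kappa>, OF \<kappa>0 \<kappa>(2)] alg_ext_single[of \<kappa>, OF \<kappa>0])
    also have "\<dots> = g (\<Sum>b | ?r b \<noteq> 0. fscale (?r b) b)"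
      using in_B fn.subspace_scale[OF subspace_dual[OF P]] by (subst g_sum) (auto simp: g(2))
    also have "(\<Sum>b | ?r b \<noteq> 0. fscale (?r b) b) = f"
      using f dual_basis[OF P] by (intro fn.sum_nonzero_representation_eq) auto
    finally show "alg_ext \<kappa> g (gen P f) = g f" .
  qed (simp_all add: alg_ext_add[of \<kappa>, OF \<kappa>0 \<kappa>(2)]
      alg_ext_mult[of \<kappa>, OF \<kappa>0 \<kappa>(2,3)] alg_ext_single[of \<kappa>, OF \<kappa>0])
  then show "\<exists>h. is_ext h" by (rule exI[where x = "alg_ext \<kappa> g"])
next
  let ?B = "dual_basis P" and ?S = "lincomb (S_mons P)"
  assume h: "is_ext h" and h': "is_ext h'" and u: "u \<in> ?S"
  have plus: "k (x + y) = k x + k y" and times: "k (x * y) = k x * k y"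
    if "is_ext k" "x \<in> ?S" "y \<in> ?S" for k x y
    using that unfolding is_ext_def by blast+
  have const: "k (Poly_Mapping.single 0 c) = \<kappa> c" if "is_ext k" for k c
    using that unfolding is_ext_def by blast
  have S_single: "Poly_Mapping.single m c \<in> ?S" if "set_mset m \<subseteq> ?B" for m and c :: 'k
    using that by (auto simp: lincomb_def S_mons_def)
  have var: "k (Poly_Mapping.single {#b#} 1) = g b" if "is_ext k" "b \<in> ?B" for k b
  proof -
    have "fn.representation ?B b = (\<lambda>v. if v = b then 1 else 0)"
      using dual_basis(2)[OF P] \<open>b \<in> ?B\<close> by (rule fn.representation_basis)
    then have "gen P b = Poly_Mapping.single {#b#} 1" by (simp add: gen_def)
    moreover have "k (gen P b) = g b"
      using that dual_basis(1)[OF P] unfolding is_ext_def by blast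
    ultimately show ?thesis by simp
  qed
  have mon: "h (Poly_Mapping.single m 1) = h' (Poly_Mapping.single m 1)" if "set_mset m \<subseteq> ?B" for m
    using that
  proof (induction m)
    case empty
    show ?case using const[OF h, of 1] const[OF h', of 1] by simp
  next
    case (add b m)
    have eq: "Poly_Mapping.single (add_mset b m) 1
        = (Poly_Mapping.single {#b#} 1 :: _ \<Rightarrow>\<^sub>0 'k) * Poly_Mapping.single m 1"
      by (simp add: mult_single)
    have S: "(Poly_Mapping.single {#b#} 1 :: _ \<Rightarrow>\<^sub>0 'k) \<in> ?S"
        "(Poly_Mapping.single m 1 :: _ \<Rightarrow>\<^sub>0 'k) \<in> ?S" and b: "b \<in> ?B" and m: "set_mset m \<subseteq> ?B"
      using add.prems by (auto intro: S_single)
    show ?case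
      unfolding eq times[OF h S] times[OF h' S] var[OF h b] var[OF h' b] add.IH[OF m] ..
  qed
  have mon_c: "h (Poly_Mapping.single m c) = h' (Poly_Mapping.single m c)"
    if "set_mset m \<subseteq> ?B" for m c
  proof -
    have eq: "Poly_Mapping.single m c = Poly_Mapping.single 0 c * Poly_Mapping.single m 1"
      by (simp add: mult_single)
    have S: "(Poly_Mapping.single 0 c :: _ \<Rightarrow>\<^sub>0 'k) \<in> ?S"
        "(Poly_Mapping.single m 1 :: _ \<Rightarrow>\<^sub>0 'k) \<in> ?S"
      using that by (auto intro: S_single)
    show ?thesis
      unfolding eq times[OF h S] times[OF h' S] const[OF h] const[OF h'] mon[OF that] ..
  qed
  have "h (\<Sum>m\<in>A. Poly_Mapping.single m (Poly_Mapping.lookup u m))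
      = h' (\<Sum>m\<in>A. Poly_Mapping.single m (Poly_Mapping.lookup u m))"
    if "finite A" "A \<subseteq> S_mons P" for A
    using that
  proof (induction A)
    case empty
    show ?case using const[OF h, of 0] const[OF h', of 0] by simp
  next
    case (insert m A)
    have m: "set_mset m \<subseteq> ?B" using insert.prems by (auto simp: S_mons_def)
    have "Poly_Mapping.keys (\<Sum>m\<in>A. Poly_Mapping.single m (Poly_Mapping.lookup u m)) \<subseteq> A"
      by (auto simp: in_keys_iff lookup_sum lookup_single when_def insert.hyps(1) split: if_splits)
    then have "(\<Sum>m\<in>A. Poly_Mapping.single m (Poly_Mapping.lookup u m)) \<in> ?S"
      using insert.prems by (auto simp: lincomb_def)
    note S = S_single[OF m] this
    show ?case
      unfolding sum.insert[OF insert.hyps] plus[OF h S] plus[OF h' S] mon_c[OF m]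
      using insert by simp
  qed
  from this[of "Poly_Mapping.keys u"] u show "h u = h' u"
    by (simp add: lincomb_def poly_mapping_eq_sum_single[of u, symmetric])
qed


section \<open>The two coproducts\<close>

text \<open>
  \<open>T(P\<^sup>*)\<close> has the words in \<open>dual_basis P\<close> as a basis, and \<open>T(P\<^sup>*) \<otimes> T(P\<^sup>*)\<close> the pairs of words.
  \<open>word_pairing\<close> is the pairing of a word in \<open>P\<^sup>*\<close> with a word in \<open>P\<close>.
\<close>

definition word_pairing :: "('p \<Rightarrow> 'k::comm_ring_1) list \<Rightarrow> 'p list \<Rightarrow> 'k" where
  "word_pairing fs xs = (if length fs = length xs then (\<Prod>i<length xs. (fs ! i) (xs ! i)) else 0)"

definition TT_pairing ::
    "(('p \<Rightarrow> 'k) list \<times> ('p \<Rightarrow> 'k) list \<Rightarrow>\<^sub>0 'k::comm_ring_1) \<Rightarrow> 'p list \<Rightarrow> 'p list \<Rightarrow> 'k" where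
  "TT_pairing w xs ys =
    (\<Sum>(fs, gs)\<in>Poly_Mapping.keys w. Poly_Mapping.lookup w (fs, gs) * (word_pairing fs xs * word_pairing gs ys))"

definition abelianize ::
    "('b list \<times> 'b list \<Rightarrow>\<^sub>0 'k::comm_monoid_add) \<Rightarrow> ('b multiset \<times> 'b multiset \<Rightarrow>\<^sub>0 'k)" where
  "abelianize w = (\<Sum>(fs, gs)\<in>Poly_Mapping.keys w. Poly_Mapping.single (mset fs, mset gs) (Poly_Mapping.lookup w (fs, gs)))"

text \<open>\<open>\<Delta>\<^sub>*(f) \<in> P\<^sup>* \<otimes> T(P\<^sup>*)\<close> for \<open>f \<in> P\<^sup>*\<close>. Elements of this space are determined by their
  pairing with \<open>q \<otimes> q\<^sub>1\<dots>q\<^sub>r\<close>, \<open>q\<close> homogeneous.\<close>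

definition Delta_star_T ::
    "('k::field, 'p::ab_group_add) operad_data \<Rightarrow> ('p \<Rightarrow> 'k)
      \<Rightarrow> (('p \<Rightarrow> 'k) list \<times> ('p \<Rightarrow> 'k) list \<Rightarrow>\<^sub>0 'k)" where
  "Delta_star_T P f = (THE w.
    w \<in> lincomb ({[b] |b. b \<in> dual_basis P} \<times> lists (dual_basis P)) \<and>
    (\<forall>p. \<forall>q\<in>ops P p. \<forall>qs. TT_pairing w [q] qs = (if length qs = p then f (opcomp P q qs) else 0)))"

text \<open>\<open>bracket_op P n p [p\<^sub>1,\<dots>,p\<^sub>k]\<close> is \<open>\<langle>p, p\<^sub>1\<dots>p\<^sub>k\<rangle>\<close> for \<open>p \<in> P(n)\<close>. Positions are counted from
  \<open>0\<close>, and \<open>A = {i\<^sub>1 < \<dots> < i\<^sub>k}\<close>: the position \<open>i \<in> A\<close> receives the entry whose index is the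
  number of elements of \<open>A\<close> below \<open>i\<close>.\<close>

definition bracket_op ::
    "('k, 'p::ab_group_add) operad_data \<Rightarrow> nat \<Rightarrow> 'p \<Rightarrow> 'p list \<Rightarrow> 'p" where
  "bracket_op P n p ps = (\<Sum>A | A \<subseteq> {..<n} \<and> card A = length ps.
    opcomp P p (map (\<lambda>i. if i \<in> A then ps ! card {j\<in>A. j < i} else opunit P) [0..<n]))"

text \<open>\<open>\<Delta>'\<^sub>*(f) \<in> T(P\<^sup>*) \<otimes> T(P\<^sup>*)\<close> for \<open>f \<in> P\<^sup>*\<close>, determined by its pairings with \<open>X \<otimes> Y\<close>;
  the three conditions are the cases \<open>X = 1\<close>, \<open>X \<in> P(n)\<close>, and \<open>X\<close> of length at least \<open>2\<close>.\<close>

definition Delta_prime_T ::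
    "('k::field, 'p::ab_group_add) operad_data \<Rightarrow> ('p \<Rightarrow> 'k)
      \<Rightarrow> (('p \<Rightarrow> 'k) list \<times> ('p \<Rightarrow> 'k) list \<Rightarrow>\<^sub>0 'k)" where
  "Delta_prime_T P f = (THE w.
    w \<in> lincomb (lists (dual_basis P) \<times> lists (dual_basis P)) \<and>
    (\<forall>Y. TT_pairing w [] Y = (case Y of [y] \<Rightarrow> f y | _ \<Rightarrow> 0)) \<and>
    (\<forall>n. \<forall>p\<in>ops P n. \<forall>Y. TT_pairing w [p] Y = f (bracket_op P n p Y)) \<and>
    (\<forall>X Y. 2 \<le> length X \<longrightarrow> TT_pairing w X Y = 0))"

text \<open>
  Both coproducts of \<open>T(P\<^sup>*)\<close> are multiplicative, so the coproducts they induce on \<open>S(P\<^sup>*)\<close> are the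
  algebra morphisms whose values on \<open>P\<^sup>*\<close> are the images of \<open>\<Delta>\<^sub>*(f)\<close>, \<open>\<Delta>'\<^sub>*(f)\<close>.
  The counits, which a bialgebra determines uniquely, are given on \<open>f \<in> P\<^sup>*\<close> by
  \<open>f(I)\<close> (this is \<open>0\<close> on \<open>P(n)\<^sup>*\<close>, \<open>n \<noteq> 1\<close>) and by \<open>0\<close>.
\<close>

definition D_star ::
    "('k::field, 'p::ab_group_add) operad_data \<Rightarrow> (('p \<Rightarrow> 'k) multiset, 'k) bialgebra_data" where
  "D_star P =
    \<lparr>mons = S_mons P,
     comult = alg_ext (Poly_Mapping.single 0) (\<lambda>b. abelianize (Delta_star_T P b)),
     counit = alg_ext id (\<lambda>b. b (opunit P))\<rparr>"

definition D_prime ::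
    "('k::field, 'p::ab_group_add) operad_data \<Rightarrow> (('p \<Rightarrow> 'k) multiset, 'k) bialgebra_data" where
  "D_prime P =
    \<lparr>mons = S_mons P,
     comult = alg_ext (Poly_Mapping.single 0) (\<lambda>b. abelianize (Delta_prime_T P b)),
     counit = alg_ext id (\<lambda>b. 0)\<rparr>"

text \<open>
  Signs: if \<open>P = P(1)\<close> is spanned by \<open>I\<close> and \<open>f(I) = 1\<close>, then \<open>\<Delta>\<^sub>*(f) = f \<otimes> f\<close> and
  \<open>\<Delta>'\<^sub>*(f) = f \<otimes> 1 + 1 \<otimes> f + f \<otimes> f\<close>, so that \<open>1 + f\<close> is group-like for \<open>\<Delta>'\<^sub>*\<close>. Thus
  \<open>f \<mapsto> f + f(I)1\<close> goes from \<open>D_star\<close> to \<open>D_prime\<close>, and its inverse \<open>f \<mapsto> f - f(I)1\<close> from \<open>D_prime\<close>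
  to \<open>D_star\<close>; in characteristic zero the minus sign is not possible in the first direction.
\<close>

end

theory Submission
  imports Defs
begin

text \<open>
  Over an infinite field \<open>S(P\<^sup>*)\<close> embeds into the functions on \<open>P\<close>, and \<open>S(P\<^sup>*) \<otimes> S(P\<^sup>*)\<close> into
  those on \<open>P \<times> P\<close>. As functions, \<open>\<Delta>\<^sub>*(f)(x, y) = f(x \<circ> y)\<close> and
  \<open>\<Delta>'\<^sub>*(f)(x, y) = f((x + I) \<circ> (y + I) - I)\<close>, where \<open>x \<circ> y\<close> is the sum over \<open>n\<close> of the
  \<open>x\<^sub>n \<circ> (y, \<dots>, y)\<close>, \<open>x\<^sub>n\<close> the component of \<open>x\<close> in \<open>P(n)\<close>. Since \<open>\<circ>\<close> is associative with unit \<open>I\<close>, both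
  are coordinate bialgebras of monoids, and the translation \<open>x \<mapsto> x + I\<close> is an isomorphism between them.
\<close>

text \<open>The obstacle is that both coproducts are given by \<open>THE\<close> on words over a
  chosen basis of the graded dual, whose elements need not be homogeneous. Coassociativity and
  compatibility with the isomorphism would be unwieldy there; at points they become identities
  between elements of P. After abelianization only the pairings with constant words x...x and y...y
  count. The translation by I comes from the bracket: placing y in some positions and I in the
  others, summed over all choices, is the multilinear expansion of q \<circ> (I + y, ..., I + y).
  The rule \<langle>1, y\<rangle> = y adds y, and y + x \<circ> (I + y) is the translated product.
  The pullback of f along x \<mapsto> x + I is f + f(I), which settles sign and direction. Points
  are finite sums of homogeneous elements; they suffice because a functional of the graded dual sees
  only finitely many P(n). Characteristic zero enters through the distinctness of the powers of 2,
  which separates monomials. P(0) = 0 and finite dimension make the coproduct of a generator a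
  finite sum of words.\<close>

section \<open>Evaluation of elements of monoid algebras\<close>

text \<open>The linear extension of \<open>\<chi>\<close> from monomials to their span; for
  multiplicative \<open>\<chi>\<close> a point of the algebra.\<close>

definition ev :: "('m \<Rightarrow> 'k) \<Rightarrow> ('m \<Rightarrow>\<^sub>0 'k::comm_ring_1) \<Rightarrow> 'k" where
  "ev \<chi> u = (\<Sum>m\<in>Poly_Mapping.keys u. Poly_Mapping.lookup u m * \<chi> m)"

definition multiplicative :: "('m::comm_monoid_add \<Rightarrow> 'k::comm_ring_1) \<Rightarrow> bool" where
  "multiplicative \<chi> \<longleftrightarrow> \<chi> 0 = 1 \<and> (\<forall>m n. \<chi> (m + n) = \<chi> m * \<chi> n)"

lemma ev_superset:
  "finite A \<Longrightarrow> Poly_Mapping.keys u \<subseteq> A \<Longrightarrow> ev \<chi> u = (\<Sum>m\<in>A. Poly_Mapping.lookup u m * \<chi> m)"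
  unfolding ev_def by (intro sum.mono_neutral_left) (auto simp: in_keys_iff)

lemma ev_zero [simp]: "ev \<chi> 0 = 0"
  by (simp add: ev_def)

lemma ev_add: "ev \<chi> (u + v) = ev \<chi> u + ev \<chi> v"
  using keys_add[of u v]
  by (simp add: ev_superset[where A = "Poly_Mapping.keys u \<union> Poly_Mapping.keys v"]
      lookup_add distrib_right sum.distrib)

lemma ev_diff: "ev \<chi> (u - v) = ev \<chi> u - ev \<chi> v"
  using ev_add[of \<chi> "u - v" v] by simp

lemma ev_sum: "ev \<chi> (sum f A) = (\<Sum>a\<in>A. ev \<chi> (f a))"
  by (induction A rule: infinite_finite_induct) (simp_all add: ev_add)

lemma ev_single [simp]: "ev \<chi> (Poly_Mapping.single m c) = c * \<chi> m"
  by (simp add: ev_superset[where A = "{m}"])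

lemma sum_single_mult:
  fixes u v :: "'m::comm_monoid_add \<Rightarrow>\<^sub>0 'k::comm_ring_1"
  shows "u * v = (\<Sum>m\<in>Poly_Mapping.keys u. \<Sum>n\<in>Poly_Mapping.keys v.
    Poly_Mapping.single (m + n) (Poly_Mapping.lookup u m * Poly_Mapping.lookup v n))"
proof -
  have "u * v = (\<Sum>m\<in>Poly_Mapping.keys u. Poly_Mapping.single m (Poly_Mapping.lookup u m))
      * (\<Sum>n\<in>Poly_Mapping.keys v. Poly_Mapping.single n (Poly_Mapping.lookup v n))"
    using poly_mapping_eq_sum_single[of u] poly_mapping_eq_sum_single[of v] by simp
  then show ?thesis by (simp add: sum_product mult_single)
qed

lemma ev_mult:
  assumes "multiplicative \<chi>"
  shows "ev \<chi> (u * v) = ev \<chi> u * ev \<chi> v"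
  using assms unfolding sum_single_mult multiplicative_def
  by (simp add: ev_sum ev_def[of \<chi> u] ev_def[of \<chi> v] sum_product mult_ac)

lemma ev_prod_mset:
  assumes "multiplicative \<chi>"
  shows "ev \<chi> (\<Prod>b\<in>#m. g b) = (\<Prod>b\<in>#m. ev \<chi> (g b))"
proof (induction m)
  case empty
  have "ev \<chi> (Poly_Mapping.single 0 1) = 1"
    using assms unfolding ev_single by (simp add: multiplicative_def)
  then show ?case by (simp only: single_one image_mset_empty prod_mset_empty)
qed (simp add: ev_mult[OF assms])

text \<open>A character after an algebra morphism is again a character, hence fixed by its values on
  the variables. Statements on coproducts and on the isomorphism thereby reduce to
  generators.\<close>

lemma ev_alg_ext:
  assumes "multiplicative \<chi>"
  shows "ev \<chi> (alg_ext (Poly_Mapping.single 0) g u) = ev (\<lambda>m. \<Prod>b\<in>#m. ev \<chi> (g b)) u"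
  using assms unfolding alg_ext_def
  by (simp add: ev_sum ev_mult ev_prod_mset ev_def[of _ u] multiplicative_def)

lemma ev_cong: "u \<in> lincomb M \<Longrightarrow> (\<And>m. m \<in> M \<Longrightarrow> \<chi> m = \<eta> m) \<Longrightarrow> ev \<chi> u = ev \<eta> u"
  unfolding ev_def lincomb_def by (intro sum.cong) auto

lemma alg_ext_id: "alg_ext id g = ev (\<lambda>m. \<Prod>b\<in>#m. g b)"
  by (simp add: fun_eq_iff alg_ext_def ev_def)

section \<open>Closure of the spans under the algebra operations\<close>

lemma lincomb_single [simp]: "m \<in> M \<Longrightarrow> Poly_Mapping.single m c \<in> lincomb M"
  by (auto simp: lincomb_def)

lemma lincomb_add: "u \<in> lincomb M \<Longrightarrow> v \<in> lincomb M \<Longrightarrow> u + v \<in> lincomb M"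
  using keys_add[of u v] by (auto simp: lincomb_def)

lemma lincomb_diff:
  fixes u v :: "'m \<Rightarrow>\<^sub>0 'k::ab_group_add"
  shows "u \<in> lincomb M \<Longrightarrow> v \<in> lincomb M \<Longrightarrow> u - v \<in> lincomb M"
  using keys_diff[of u v] by (auto simp: lincomb_def)

lemma lincomb_sum: "(\<And>a. a \<in> A \<Longrightarrow> f a \<in> lincomb M) \<Longrightarrow> sum f A \<in> lincomb M"
  by (induction A rule: infinite_finite_induct) (auto intro!: lincomb_add, auto simp: lincomb_def)

text \<open>The type of monomials contains all multisets, not only those over the chosen basis;
  closure of \<open>M\<close> makes \<open>lincomb M\<close> a subalgebra.\<close>

definition submonoid :: "'m::comm_monoid_add set \<Rightarrow> bool" where
  "submonoid M \<longleftrightarrow> 0 \<in> M \<and> (\<forall>m\<in>M. \<forall>n\<in>M. m + n \<in> M)"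

lemma submonoid_Times: "submonoid M \<Longrightarrow> submonoid N \<Longrightarrow> submonoid (M \<times> N)"
  by (auto simp: submonoid_def zero_prod_def)

lemma lincomb_mult:
  fixes u v :: "'m::comm_monoid_add \<Rightarrow>\<^sub>0 'k::comm_ring_1"
  assumes "submonoid M" "u \<in> lincomb M" "v \<in> lincomb M"
  shows "u * v \<in> lincomb M"
  unfolding sum_single_mult using assms
  by (intro lincomb_sum lincomb_single) (auto simp: submonoid_def lincomb_def)

lemma lincomb_alg_ext:
  fixes u :: "'b multiset \<Rightarrow>\<^sub>0 'k::comm_ring_1"
  assumes M: "submonoid M" and g: "\<And>b. b \<in> B \<Longrightarrow> g b \<in> lincomb M"
    and u: "u \<in> lincomb {m. set_mset m \<subseteq> B}"
  shows "alg_ext (Poly_Mapping.single 0) g u \<in> lincomb M"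
proof -
  have "(\<Prod>b\<in>#m. g b) \<in> lincomb M" if "set_mset m \<subseteq> B" for m
    using that
  proof (induction m)
    case empty
    have "(Poly_Mapping.single 0 1 :: _ \<Rightarrow>\<^sub>0 'k) \<in> lincomb M"
      using M by (intro lincomb_single) (auto simp: submonoid_def)
    then show ?case by (simp only: single_one image_mset_empty prod_mset_empty)
  next
    case (add b m)
    then show ?case using g by (auto intro!: lincomb_mult[OF M])
  qed
  moreover have "set_mset m \<subseteq> B" if "m \<in> Poly_Mapping.keys u" for m
    using u that by (auto simp: lincomb_def)
  moreover have "Poly_Mapping.single 0 c \<in> lincomb M" for c :: 'k
    using M by (intro lincomb_single) (auto simp: submonoid_def)
  ultimately show ?thesis
    unfolding alg_ext_def by (intro lincomb_sum lincomb_mult[OF M]) auto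
qed

lemma alg_hom_alg_ext:
  assumes "submonoid N" "\<And>b. b \<in> B \<Longrightarrow> g b \<in> lincomb N"
  shows "alg_hom {m. set_mset m \<subseteq> B} N (alg_ext (Poly_Mapping.single 0) g)"
  unfolding alg_hom_def using lincomb_alg_ext[of N B g] assms
  by (auto simp: alg_ext_add[of "Poly_Mapping.single 0"] alg_ext_mult[of "Poly_Mapping.single 0"]
      alg_ext_single[of "Poly_Mapping.single 0"] single_add mult_single)

lemma character_alg_ext: "character M (alg_ext id g)"
  unfolding character_def by (simp add: alg_ext_add alg_ext_mult alg_ext_single)

section \<open>Points and morphisms on tensor products\<close>

definition pchar :: "('m \<Rightarrow> 'k::comm_ring_1) \<Rightarrow> ('n \<Rightarrow> 'k) \<Rightarrow> 'm \<times> 'n \<Rightarrow> 'k" where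
  "pchar \<chi> \<eta> = (\<lambda>(m, n). \<chi> m * \<eta> n)"

lemma multiplicative_pchar:
  "multiplicative \<chi> \<Longrightarrow> multiplicative \<eta> \<Longrightarrow> multiplicative (pchar \<chi> \<eta>)"
  by (auto simp: multiplicative_def pchar_def zero_prod_def mult_ac)

lemma ev_tensor: "ev (pchar \<chi> \<eta>) (tensor u v) = ev \<chi> u * ev \<eta> v"
  by (simp add: tensor_def ev_sum pchar_def ev_def[of _ u] ev_def[of _ v] sum_product mult_ac)

text \<open>\<open>tensor_map\<close> is defined on bases, so only the values of \<open>g\<close>
  and \<open>h\<close> on monomials enter: evaluation after \<open>g\<close> and \<open>h\<close> is
  evaluation at the pulled back pair.\<close>

lemma ev_tensor_map:
  assumes "multiplicative \<chi>'" "multiplicative \<eta>'" "w \<in> lincomb (M \<times> N)"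
    and "\<And>m. m \<in> M \<Longrightarrow> ev \<chi>' (g (Poly_Mapping.single m 1)) = \<chi> m"
    and "\<And>n. n \<in> N \<Longrightarrow> ev \<eta>' (h (Poly_Mapping.single n 1)) = \<eta> n"
  shows "ev (pchar \<chi>' \<eta>') (tensor_map g h w) = ev (pchar \<chi> \<eta>) w"
proof -
  have m: "multiplicative (pchar \<chi>' \<eta>')" using assms by (simp add: multiplicative_pchar)
  then have 1: "pchar \<chi>' \<eta>' 0 = 1" by (simp add: multiplicative_def)
  have "ev (pchar \<chi>' \<eta>') (tensor_map g h w) = (\<Sum>(m, n)\<in>Poly_Mapping.keys w.
      Poly_Mapping.lookup w (m, n) * (ev \<chi>' (g (Poly_Mapping.single m 1)) * ev \<eta>' (h (Poly_Mapping.single n 1))))"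
    by (simp add: tensor_map_def ev_sum ev_mult[OF m] ev_tensor 1 case_prod_unfold)
  also have "\<dots> = ev (pchar \<chi> \<eta>) w"
    unfolding ev_def[of _ w] pchar_def using assms(3-) by (intro sum.cong) (auto simp: lincomb_def)
  finally show ?thesis .
qed

lemma ev_reassoc: "ev (pchar \<chi> (pchar \<eta> \<zeta>)) (reassoc w) = ev (pchar (pchar \<chi> \<eta>) \<zeta>) w"
  by (simp add: reassoc_def ev_sum ev_def[of _ w] case_prod_unfold pchar_def mult_ac)

lemma lincomb_tensor: "u \<in> lincomb M \<Longrightarrow> v \<in> lincomb N \<Longrightarrow> tensor u v \<in> lincomb (M \<times> N)"
  unfolding tensor_def by (intro lincomb_sum lincomb_single) (auto simp: lincomb_def)

lemma lincomb_tensor_map: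
  assumes "submonoid M'" "submonoid N'" "w \<in> lincomb (M \<times> N)"
    and "\<And>m. m \<in> M \<Longrightarrow> g (Poly_Mapping.single m 1) \<in> lincomb M'"
    and "\<And>n. n \<in> N \<Longrightarrow> h (Poly_Mapping.single n 1) \<in> lincomb N'"
  shows "tensor_map g h w \<in> lincomb (M' \<times> N')"
proof -
  have "0 \<in> M' \<times> N'" using assms(1,2) by (simp add: submonoid_def zero_prod_def)
  moreover have "fst p \<in> M" "snd p \<in> N" if "p \<in> Poly_Mapping.keys w" for p
    using that assms(3) by (auto simp: lincomb_def)
  ultimately show ?thesis
    unfolding tensor_map_def case_prod_unfold using assms
    by (intro lincomb_sum lincomb_mult submonoid_Times lincomb_single lincomb_tensor) blast+
qed

lemma lincomb_reassoc: "w \<in> lincomb ((L \<times> M) \<times> N) \<Longrightarrow> reassoc w \<in> lincomb (L \<times> M \<times> N)"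
  unfolding reassoc_def case_prod_unfold
  by (intro lincomb_sum lincomb_single) (auto simp: lincomb_def)

text \<open>Linear independence of the functions \<open>\<lambda>x. \<chi> x m\<close> for
  \<open>m \<in> M\<close>. As \<open>\<chi> x\<close> may be any function, words of the tensor
  algebra are covered too.\<close>

definition separating :: "'m set \<Rightarrow> ('x \<Rightarrow> 'm \<Rightarrow> 'k::comm_ring_1) \<Rightarrow> bool" where
  "separating M \<chi> \<longleftrightarrow> (\<forall>u\<in>lincomb M. (\<forall>x. ev (\<chi> x) u = 0) \<longrightarrow> u = 0)"

lemma separatingD:
  assumes "separating M \<chi>" "u \<in> lincomb M" "v \<in> lincomb M" "\<And>x. ev (\<chi> x) u = ev (\<chi> x) v"
  shows "u = v"
proof -
  have "u - v \<in> lincomb M" and "\<forall>x. ev (\<chi> x) (u - v) = 0"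
    using assms by (auto simp: ev_diff intro: lincomb_diff)
  then have "u - v = 0" using assms(1) unfolding separating_def by blast
  then show ?thesis by simp
qed

lemma separating_coeffs:
  assumes "separating M \<chi>" "finite A" "A \<subseteq> M" "\<And>x. (\<Sum>m\<in>A. c m * \<chi> x m) = 0" "m \<in> A"
  shows "c m = 0"
proof -
  let ?u = "\<Sum>m\<in>A. Poly_Mapping.single m (c m)"
  have "?u \<in> lincomb M" using assms by (intro lincomb_sum lincomb_single) auto
  moreover have "ev (\<chi> x) ?u = 0" for x using assms by (simp add: ev_sum)
  ultimately have "?u = 0" using assms(1) by (auto simp: separating_def)
  then have "Poly_Mapping.lookup ?u m = 0" by simp
  then show ?thesis using assms(2,5) by (simp add: lookup_sum lookup_single when_def)
qed

text \<open>For fixed \<open>y\<close>, a relation is one between functions of \<open>x\<close> with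
  coefficients depending on \<open>y\<close>. These vanish for each \<open>y\<close>, and
  independence in the second variable finishes. Iteration handles the triple tensors of
  coassociativity.\<close>

lemma separating_Times:
  assumes M: "separating M \<chi>" and N: "separating N \<eta>"
  shows "separating (M \<times> N) (\<lambda>(x, y). pchar (\<chi> x) (\<eta> y))"
  unfolding separating_def
proof (intro ballI impI)
  fix u assume u: "u \<in> lincomb (M \<times> N)"
    and 0: "\<forall>z. ev (case z of (x, y) \<Rightarrow> pchar (\<chi> x) (\<eta> y)) u = 0"
  let ?A = "fst ` Poly_Mapping.keys u" and ?B = "snd ` Poly_Mapping.keys u"
  have sub: "Poly_Mapping.keys u \<subseteq> ?A \<times> ?B" by force
  have A: "finite ?A" "?A \<subseteq> M" and B: "finite ?B" "?B \<subseteq> N"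
    using u by (auto simp: lincomb_def)
  have "(\<Sum>m\<in>?A. (\<Sum>n\<in>?B. Poly_Mapping.lookup u (m, n) * \<eta> y n) * \<chi> x m) = 0" for x y
  proof -
    have "ev (pchar (\<chi> x) (\<eta> y)) u = 0" using 0 by (auto dest: spec[of _ "(x, y)"])
    moreover have "ev (pchar (\<chi> x) (\<eta> y)) u
        = (\<Sum>m\<in>?A. \<Sum>n\<in>?B. Poly_Mapping.lookup u (m, n) * (\<chi> x m * \<eta> y n))"
      using A(1) B(1) by (simp add: ev_superset[OF _ sub] sum.cartesian_product case_prod_unfold pchar_def)
    ultimately show ?thesis by (simp add: sum_distrib_left sum_distrib_right mult_ac)
  qed
  from separating_coeffs[OF M A this]
  have "(\<Sum>n\<in>?B. Poly_Mapping.lookup u (m, n) * \<eta> y n) = 0" if "m \<in> ?A" for m y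
    using that by blast
  from separating_coeffs[OF N B this]
  have "Poly_Mapping.lookup u (m, n) = 0" if "m \<in> ?A" "n \<in> ?B" for m n
    using that by blast
  then have "Poly_Mapping.lookup u p = 0" if "p \<in> Poly_Mapping.keys u" for p
    using that sub by (cases p) blast
  then show "u = 0" by (intro poly_mapping_eqI) (auto simp: in_keys_iff)
qed

text \<open>Dedekind's argument: monomials are characters of the multiplicative monoid of all \<open>c\<close>.\<close>

lemma monomials_independent:
  fixes a :: "'b multiset \<Rightarrow> 'k::field_char_0"
  assumes "finite A" "\<And>c :: 'b \<Rightarrow> 'k. (\<Sum>m\<in>A. a m * (\<Prod>b\<in>#m. c b)) = 0" "m \<in> A"
  shows "a m = 0"
  using assms
proof (induction A arbitrary: a m)
  case (insert n A)
  have A: "a m = 0" if m: "m \<in> A" for m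
  proof -
    have "m \<noteq> n" using insert m by auto
    then obtain b where b: "count m b \<noteq> count n b" by (auto simp: multiset_eq_iff)
    \<comment> \<open>The point \<open>d\<close> takes the value 2 at a variable where
      \<open>m\<close> and \<open>n\<close> have different exponents, so their values are distinct
      powers of 2.\<close>
    define d :: "'b \<Rightarrow> 'k" where "d = (\<lambda>x. if x = b then 2 else 1)"
    have d: "(\<Prod>x\<in>#k. d x) = 2 ^ count k b" for k by (induction k) (auto simp: d_def)
    have "a m * ((\<Prod>x\<in>#m. d x) - (\<Prod>x\<in>#n. d x)) = 0"
    proof (rule insert.IH[OF _ m])
      fix c :: "'b \<Rightarrow> 'k"
      \<comment> \<open>The relation at \<open>c * d\<close> minus the value of \<open>n\<close> at
        \<open>d\<close> times the relation at \<open>c\<close>: the term of \<open>n\<close>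
        cancels.\<close>
      have "(\<Sum>k\<in>insert n A. a k * (\<Prod>x\<in>#k. c x * d x)) - (\<Prod>x\<in>#n. d x) * (\<Sum>k\<in>insert n A. a k * (\<Prod>x\<in>#k. c x)) = 0"
        unfolding insert.prems by simp
      then show "(\<Sum>k\<in>A. a k * ((\<Prod>x\<in>#k. d x) - (\<Prod>x\<in>#n. d x)) * (\<Prod>x\<in>#k. c x)) = 0"
        using insert.hyps
        by (simp add: prod_mset.distrib algebra_simps sum_subtractf sum_distrib_left)
    qed
    moreover have "(2::'k) ^ i \<noteq> 2 ^ j" if "i \<noteq> j" for i j
    proof
      assume "(2::'k) ^ i = 2 ^ j"
      then have "(of_nat (2 ^ i) :: 'k) = of_nat (2 ^ j)" by simp
      then have "(2::nat) ^ i = 2 ^ j" by (simp only: of_nat_eq_iff)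
      then show False using that by simp
    qed
    ultimately show ?thesis using b by (simp add: d)
  qed
  have "a n = 0"
    using insert.prems(1)[of "\<lambda>_. 1"] insert.hyps A by simp
  with A insert.prems show ?case by auto
qed simp

text \<open>The variables are themselves functions on the points, so a point assigns a value to each
  of them.\<close>

definition mon :: "'x \<Rightarrow> ('x \<Rightarrow> 'k::comm_ring_1) multiset \<Rightarrow> 'k" where
  "mon x m = (\<Prod>b\<in>#m. b x)"

lemma multiplicative_mon: "multiplicative (mon x)"
  by (simp add: multiplicative_def mon_def)

lemma prod_mset_eq_mon:
  "set_mset m \<subseteq> B \<Longrightarrow> (\<And>b. b \<in> B \<Longrightarrow> g b = b x) \<Longrightarrow> (\<Prod>b\<in>#m. g b) = mon x m"
  unfolding mon_def by (intro arg_cong[of _ _ prod_mset] image_mset_cong) auto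

lemma ev_mon_alg_ext:
  assumes "u \<in> lincomb {m. set_mset m \<subseteq> B}" "\<And>b. b \<in> B \<Longrightarrow> ev (mon x) (T b) = b y"
  shows "ev (mon x) (alg_ext (Poly_Mapping.single 0) T u) = ev (mon y) u"
  unfolding ev_alg_ext[OF multiplicative_mon] using assms
  by (intro ev_cong[OF assms(1)]) (auto intro!: prod_mset_eq_mon)

text \<open>\<open>S(P\<^sup>*)\<close> embeds into the functions on \<open>P\<close> by this criterion.\<close>

lemma separating_mon:
  fixes B :: "('x \<Rightarrow> 'k::field_char_0) set"
  assumes "\<And>F c. finite F \<Longrightarrow> F \<subseteq> B \<Longrightarrow> \<exists>x. \<forall>b\<in>F. b x = c b"
  shows "separating {m. set_mset m \<subseteq> B} mon"
  unfolding separating_def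
proof (intro ballI impI)
  fix u :: "('x \<Rightarrow> 'k) multiset \<Rightarrow>\<^sub>0 'k"
  assume u: "u \<in> lincomb {m. set_mset m \<subseteq> B}" and 0: "\<forall>x. ev (mon x) u = 0"
  have "Poly_Mapping.lookup u m = 0" if "m \<in> Poly_Mapping.keys u" for m
  proof (rule monomials_independent[OF _ _ that])
    fix c :: "('x \<Rightarrow> 'k) \<Rightarrow> 'k"
    \<comment> \<open>Only the finitely many variables occurring in \<open>u\<close> need prescribed
      values.\<close>
    let ?F = "\<Union>m\<in>Poly_Mapping.keys u. set_mset m"
    obtain x where x: "\<forall>b\<in>?F. b x = c b"
      using assms[of ?F c] u by (auto simp: lincomb_def)
    have "(\<Sum>m\<in>Poly_Mapping.keys u. Poly_Mapping.lookup u m * (\<Prod>b\<in>#m. c b)) = ev (mon x) u"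
      unfolding ev_def mon_def using x
      by (intro sum.cong arg_cong2[of _ _ _ _ "(*)"] arg_cong[of _ _ prod_mset] image_mset_cong) auto
    with 0 show "(\<Sum>m\<in>Poly_Mapping.keys u. Poly_Mapping.lookup u m * (\<Prod>b\<in>#m. c b)) = 0" by simp
  qed simp
  then show "u = 0" by (intro poly_mapping_eqI) (auto simp: in_keys_iff)
qed

lemma submonoid_mons: "submonoid {m. set_mset m \<subseteq> B}"
  by (auto simp: submonoid_def)

section \<open>Coordinate bialgebras of monoids\<close>

text \<open>\<open>D\<close> and \<open>E\<close> are pullbacks along the multiplication and the
  unit. \<open>D_in\<close> demands that the pullback of a variable be an element of the tensor
  square, not just a function of two points.\<close>

locale point_bialgebra =
  fixes B :: "('x \<Rightarrow> 'k::field) set" and M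
    and D :: "('x \<Rightarrow> 'k) \<Rightarrow> (('x \<Rightarrow> 'k) multiset \<times> ('x \<Rightarrow> 'k) multiset \<Rightarrow>\<^sub>0 'k)"
    and E :: "('x \<Rightarrow> 'k) \<Rightarrow> 'k"
    and mul :: "'x \<Rightarrow> 'x \<Rightarrow> 'x" and e :: 'x
  defines "M \<equiv> {m. set_mset m \<subseteq> B}"
  assumes sep: "separating M (mon :: 'x \<Rightarrow> _)"
    and D_in: "b \<in> B \<Longrightarrow> D b \<in> lincomb (M \<times> M)"
    and ev_D: "b \<in> B \<Longrightarrow> ev (pchar (mon x) (mon y)) (D b) = b (mul x y)"
    and E: "b \<in> B \<Longrightarrow> E b = b e"
    and mul_assoc: "mul (mul x y) z = mul x (mul y z)"
    and mul_e: "mul e x = x" "mul x e = x"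
begin

abbreviation (input) "\<Delta> \<equiv> alg_ext (Poly_Mapping.single 0) D"
abbreviation (input) "\<epsilon> \<equiv> alg_ext id E"

lemma submonoid: "submonoid M"
  by (simp add: M_def submonoid_mons)

lemma Delta_in: "u \<in> lincomb M \<Longrightarrow> \<Delta> u \<in> lincomb (M \<times> M)"
  using lincomb_alg_ext[of "M \<times> M" B D u] D_in submonoid
  by (simp add: submonoid_Times M_def)

lemma mon_eqI: "m \<in> M \<Longrightarrow> (\<And>b. b \<in> B \<Longrightarrow> g b = b x) \<Longrightarrow> (\<Prod>b\<in>#m. g b) = mon x m"
  unfolding M_def by (auto intro: prod_mset_eq_mon)

lemma ev_Delta:
  assumes "u \<in> lincomb M"
  shows "ev (pchar (mon x) (mon y)) (\<Delta> u) = ev (mon (mul x y)) u"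
proof -
  have "multiplicative (pchar (mon x) (mon y))"
    by (simp add: multiplicative_pchar multiplicative_mon)
  show ?thesis
    unfolding ev_alg_ext[OF \<open>multiplicative (pchar (mon x) (mon y))\<close>]
    by (auto intro!: ev_cong[OF assms] mon_eqI ev_D)
qed

lemma counit_eq: "u \<in> lincomb M \<Longrightarrow> \<epsilon> u = ev (mon e) u"
  unfolding alg_ext_id by (rule ev_cong) (auto intro!: mon_eqI E)

text \<open>At points, the two sides of coassociativity are \<open>u\<close> at
  \<open>mul (mul x y) z\<close> and at \<open>mul x (mul y z)\<close>, and the counit laws are the
  unit laws. Multiplicativity is built into \<open>alg_ext\<close>.\<close>

lemma bialgebra: "bialgebra \<lparr>mons = M, comult = \<Delta>, counit = \<epsilon>\<rparr>"
proof -
  have "reassoc (tensor_map \<Delta> id (\<Delta> u)) = tensor_map id \<Delta> (\<Delta> u)" if u: "u \<in> lincomb M" for u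
  proof (rule separatingD[OF separating_Times[OF sep separating_Times[OF sep sep]]])
    note \<Delta> = Delta_in[OF u]
    show "reassoc (tensor_map \<Delta> id (\<Delta> u)) \<in> lincomb (M \<times> M \<times> M)"
      by (intro lincomb_reassoc lincomb_tensor_map[OF _ _ \<Delta>])
        (auto intro: submonoid_Times submonoid Delta_in)
    show "tensor_map id \<Delta> (\<Delta> u) \<in> lincomb (M \<times> M \<times> M)"
      by (intro lincomb_tensor_map[OF _ _ \<Delta>])
        (auto intro: submonoid_Times submonoid Delta_in)
    have "ev (pchar (mon x) (pchar (mon y) (mon z))) (reassoc (tensor_map \<Delta> id (\<Delta> u)))
        = ev (pchar (mon x) (pchar (mon y) (mon z))) (tensor_map id \<Delta> (\<Delta> u))" for x y z
    proof -
      have "ev (pchar (pchar (mon x) (mon y)) (mon z)) (tensor_map \<Delta> id (\<Delta> u))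
          = ev (pchar (mon (mul x y)) (mon z)) (\<Delta> u)"
        by (rule ev_tensor_map[OF _ _ \<Delta>])
          (auto intro: multiplicative_pchar multiplicative_mon simp: ev_Delta)
      moreover have "ev (pchar (mon x) (pchar (mon y) (mon z))) (tensor_map id \<Delta> (\<Delta> u))
          = ev (pchar (mon x) (mon (mul y z))) (\<Delta> u)"
        by (rule ev_tensor_map[OF _ _ \<Delta>])
          (auto intro: multiplicative_pchar multiplicative_mon simp: ev_Delta)
      ultimately show ?thesis by (simp add: ev_reassoc ev_Delta u mul_assoc)
    qed
    then show "ev ((\<lambda>(x, z). pchar (mon x) ((\<lambda>(x, y). pchar (mon x) (mon y)) z)) p)
          (reassoc (tensor_map \<Delta> id (\<Delta> u)))
        = ev ((\<lambda>(x, z). pchar (mon x) ((\<lambda>(x, y). pchar (mon x) (mon y)) z)) p)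
          (tensor_map id \<Delta> (\<Delta> u))" for p
      by (auto split: prod.splits)
  qed
  moreover have "(\<Sum>(m, n)\<in>Poly_Mapping.keys (\<Delta> u). Poly_Mapping.single n
      (Poly_Mapping.lookup (\<Delta> u) (m, n) * \<epsilon> (Poly_Mapping.single m 1))) = u" (is "?s = u")
    if u: "u \<in> lincomb M" for u
  proof (rule separatingD[OF sep _ u])
    have keys: "Poly_Mapping.keys (\<Delta> u) \<subseteq> M \<times> M" using Delta_in[OF u] by (simp add: lincomb_def)
    show "?s \<in> lincomb M" using keys by (intro lincomb_sum) auto
    have "ev (mon x) ?s = ev (pchar (mon e) (mon x)) (\<Delta> u)" for x
      unfolding ev_sum ev_def[of _ "\<Delta> u"] using keys
      by (intro sum.cong) (auto simp: counit_eq pchar_def)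
    then show "ev (mon x) ?s = ev (mon x) u" for x by (simp add: ev_Delta u mul_e)
  qed
  moreover have "(\<Sum>(m, n)\<in>Poly_Mapping.keys (\<Delta> u). Poly_Mapping.single m
      (Poly_Mapping.lookup (\<Delta> u) (m, n) * \<epsilon> (Poly_Mapping.single n 1))) = u" (is "?s = u")
    if u: "u \<in> lincomb M" for u
  proof (rule separatingD[OF sep _ u])
    have keys: "Poly_Mapping.keys (\<Delta> u) \<subseteq> M \<times> M" using Delta_in[OF u] by (simp add: lincomb_def)
    show "?s \<in> lincomb M" using keys by (intro lincomb_sum) auto
    have "ev (mon x) ?s = ev (pchar (mon x) (mon e)) (\<Delta> u)" for x
      unfolding ev_sum ev_def[of _ "\<Delta> u"] using keys
      by (intro sum.cong) (auto simp: counit_eq pchar_def)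
    then show "ev (mon x) ?s = ev (mon x) u" for x by (simp add: ev_Delta u mul_e)
  qed
  moreover have "alg_hom M (M \<times> M) \<Delta>"
    unfolding M_def using D_in submonoid
    by (intro alg_hom_alg_ext) (auto simp: M_def intro: submonoid_Times)
  ultimately show ?thesis
    unfolding bialgebra_def using submonoid
    by (simp add: submonoid_def character_alg_ext)
qed

end

text \<open>Pullback reverses arrows: \<open>\<theta>\<close> is a morphism from the monoid of the
  second bialgebra to that of the first. \<open>T\<close> and \<open>T'\<close> are pullbacks along
  \<open>\<theta>\<close> and \<open>\<theta>'\<close>, hence induce mutually inverse maps.\<close>

lemma bialgebra_iso_points:
  assumes A: "point_bialgebra B D E mul e" and A': "point_bialgebra B D' E' mul' e'"
    and T: "\<And>b. b \<in> B \<Longrightarrow> T b \<in> lincomb {m. set_mset m \<subseteq> B}"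
      "\<And>b x. b \<in> B \<Longrightarrow> ev (mon x) (T b) = b (\<theta> x)"
    and T': "\<And>b. b \<in> B \<Longrightarrow> T' b \<in> lincomb {m. set_mset m \<subseteq> B}"
      "\<And>b x. b \<in> B \<Longrightarrow> ev (mon x) (T' b) = b (\<theta>' x)"
    and inverse: "\<And>x. \<theta> (\<theta>' x) = x" "\<And>x. \<theta>' (\<theta> x) = x"
    and hom: "\<And>x y. \<theta> (mul' x y) = mul (\<theta> x) (\<theta> y)" "\<theta> e' = e"
  shows "bialgebra_iso
    \<lparr>mons = {m. set_mset m \<subseteq> B}, comult = alg_ext (Poly_Mapping.single 0) D, counit = alg_ext id E\<rparr>
    \<lparr>mons = {m. set_mset m \<subseteq> B}, comult = alg_ext (Poly_Mapping.single 0) D', counit = alg_ext id E'\<rparr>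
    (alg_ext (Poly_Mapping.single 0) T)"
proof -
  interpret A: point_bialgebra B "{m. set_mset m \<subseteq> B}" D E mul e
    using A by simp
  interpret A': point_bialgebra B "{m. set_mset m \<subseteq> B}" D' E' mul' e'
    using A' by simp
  let ?M = "{m. set_mset m \<subseteq> B}"
  let ?h = "alg_ext (Poly_Mapping.single 0) T" and ?h' = "alg_ext (Poly_Mapping.single 0) T'"
  have h_in: "?h u \<in> lincomb ?M" if "u \<in> lincomb ?M" for u
    using that T by (intro lincomb_alg_ext[where B = B] submonoid_mons)
  have h'_in: "?h' u \<in> lincomb ?M" if "u \<in> lincomb ?M" for u
    using that T' by (intro lincomb_alg_ext[where B = B] submonoid_mons)
  have ev_h: "ev (mon x) (?h u) = ev (mon (\<theta> x)) u" if u: "u \<in> lincomb ?M" for u x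
    using u T(2) by (rule ev_mon_alg_ext)
  have ev_h': "ev (mon x) (?h' u) = ev (mon (\<theta>' x)) u" if u: "u \<in> lincomb ?M" for u x
    using u T'(2) by (rule ev_mon_alg_ext)
  have "bij_betw ?h (lincomb ?M) (lincomb ?M)"
  proof (rule bij_betw_byWitness[where f' = ?h'])
    show "\<forall>u\<in>lincomb ?M. ?h' (?h u) = u"
      by (intro ballI separatingD[OF A.sep] h_in h'_in) (simp_all only: ev_h ev_h' h_in inverse)
    show "\<forall>u\<in>lincomb ?M. ?h (?h' u) = u"
      by (intro ballI separatingD[OF A.sep] h_in h'_in) (simp_all only: ev_h ev_h' h'_in inverse)
  qed (auto intro: h_in h'_in)
  moreover have "A'.\<Delta> (?h u) = tensor_map ?h ?h (A.\<Delta> u)" if u: "u \<in> lincomb ?M" for u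
  proof (rule separatingD[OF separating_Times[OF A.sep A.sep]])
    show "A'.\<Delta> (?h u) \<in> lincomb (?M \<times> ?M)"
      by (intro A'.Delta_in h_in u)
    show "tensor_map ?h ?h (A.\<Delta> u) \<in> lincomb (?M \<times> ?M)"
      by (rule lincomb_tensor_map[OF _ _ A.Delta_in[OF u]]) (auto intro: submonoid_mons h_in)
    fix p :: "'a \<times> 'a"
    obtain x y where p: "p = (x, y)" by (cases p)
    have "ev (pchar (mon x) (mon y)) (tensor_map ?h ?h (A.\<Delta> u))
        = ev (pchar (mon (\<theta> x)) (mon (\<theta> y))) (A.\<Delta> u)"
      by (rule ev_tensor_map[OF _ _ A.Delta_in[OF u]]) (auto simp: multiplicative_mon ev_h)
    then show "ev (case p of (x, y) \<Rightarrow> pchar (mon x) (mon y)) (A'.\<Delta> (?h u))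
        = ev (case p of (x, y) \<Rightarrow> pchar (mon x) (mon y)) (tensor_map ?h ?h (A.\<Delta> u))"
      by (simp add: p A'.ev_Delta h_in u ev_h A.ev_Delta hom)
  qed
  moreover have "A'.\<epsilon> (?h u) = A.\<epsilon> u" if u: "u \<in> lincomb ?M" for u
    by (simp add: A.counit_eq A'.counit_eq h_in u ev_h hom)
  ultimately show ?thesis
    using A.bialgebra A'.bialgebra T(1)
    by (simp add: bialgebra_iso_def alg_hom_alg_ext submonoid_mons)
qed

section \<open>Insertions and the bracket\<close>

lemma word_pairing_Nil [simp]: "word_pairing [] xs = (if xs = [] then 1 else 0)"
  by (simp add: word_pairing_def)

lemma word_pairing_Cons [simp]:
  "word_pairing (f # fs) (x # xs) = f x * word_pairing fs xs"
  "word_pairing (f # fs) [] = 0"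
  by (simp_all add: word_pairing_def prod.lessThan_Suc_shift del: prod.lessThan_Suc)

lemma word_pairing_length: "length fs \<noteq> length xs \<Longrightarrow> word_pairing fs xs = 0"
  by (simp add: word_pairing_def)

lemma TT_pairing_ev:
  "TT_pairing w xs ys = ev (pchar (\<lambda>fs. word_pairing fs xs) (\<lambda>gs. word_pairing gs ys)) w"
  by (simp add: TT_pairing_def ev_def pchar_def case_prod_unfold)

abbreviation (input) words :: "'b set \<Rightarrow> nat \<Rightarrow> 'b list set" where
  "words K n \<equiv> {ks. set ks \<subseteq> K \<and> length ks = n}"

lemma sum_words_Suc: "(\<Sum>ks\<in>words K (Suc n). h ks) = (\<Sum>k\<in>K. \<Sum>ks\<in>words K n. h (k # ks))"
proof -
  have "inj_on (\<lambda>(ks, k). k # ks) (words K n \<times> K)" by (auto simp: inj_on_def)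
  then have "(\<Sum>ks\<in>words K (Suc n). h ks) = (\<Sum>(ks, k)\<in>words K n \<times> K. h (k # ks))"
    by (simp add: lists_length_Suc_eq sum.reindex case_prod_unfold)
  also have "\<dots> = (\<Sum>k\<in>K. \<Sum>ks\<in>words K n. h (k # ks))"
    by (subst sum.swap) (simp add: sum.cartesian_product)
  finally show ?thesis .
qed

text \<open>\<open>insertion_sum u n ys \<Phi>\<close> is the sum of \<open>\<Phi>\<close> over the lists of length \<open>n\<close> that arise from \<open>ys\<close>
  by inserting copies of \<open>u\<close>: the recursion on \<open>n\<close> replaces the subsets in \<open>bracket_op\<close>.\<close>

primrec insertion_sum :: "'x \<Rightarrow> nat \<Rightarrow> 'x list \<Rightarrow> ('x list \<Rightarrow> 'c::comm_monoid_add) \<Rightarrow> 'c" where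
  "insertion_sum u 0 ys \<Phi> = (if ys = [] then \<Phi> [] else 0)"
| "insertion_sum u (Suc n) ys \<Phi> = insertion_sum u n ys (\<lambda>zs. \<Phi> (u # zs)) +
    (case ys of [] \<Rightarrow> 0 | y # ys' \<Rightarrow> insertion_sum u n ys' (\<lambda>zs. \<Phi> (y # zs)))"

text \<open>Subsets are split by whether they contain 0, and the rest is shifted down. The condition
  \<open>Suc (card A) = k\<close> is not \<open>card A = k - 1\<close>, which for
  \<open>k = 0\<close> would wrongly admit the empty set.\<close>

lemma sum_subsets_Suc:
  fixes h :: "nat set \<Rightarrow> 'c::comm_monoid_add"
  shows "(\<Sum>A | A \<subseteq> {..<Suc n} \<and> card A = k. h A) =
    (\<Sum>A | A \<subseteq> {..<n} \<and> card A = k. h (Suc ` A)) +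
    (\<Sum>A | A \<subseteq> {..<n} \<and> Suc (card A) = k. h (insert 0 (Suc ` A)))"
proof -
  let ?X = "{A. A \<subseteq> {..<n} \<and> card A = k}" and ?Y = "{A. A \<subseteq> {..<n} \<and> Suc (card A) = k}"
  have fin: "finite ?X" "finite ?Y" by (rule finite_subset[of _ "Pow {..<n}"]; auto)+
  have ins: "card (insert 0 (Suc ` A)) = Suc (card A)" if "A \<subseteq> {..<n}" for A
    using finite_subset[OF that] by (simp add: card_image)
  have "{A. A \<subseteq> {..<Suc n} \<and> card A = k} = image Suc ` ?X \<union> (\<lambda>A. insert 0 (Suc ` A)) ` ?Y"
  proof (intro equalityI subsetI)
    fix A assume A: "A \<in> {A. A \<subseteq> {..<Suc n} \<and> card A = k}"
    define A' where "A' = {i. Suc i \<in> A}"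
    have A': "A' \<subseteq> {..<n}" using A by (auto simp: A'_def)
    have eq: "A - {0} = Suc ` A'" by (auto simp: A'_def image_iff) (metis not0_implies_Suc)
    show "A \<in> image Suc ` ?X \<union> (\<lambda>A. insert 0 (Suc ` A)) ` ?Y"
    proof (cases "0 \<in> A")
      case True
      then have "A = insert 0 (Suc ` A')" using eq by blast
      then show ?thesis using A A' ins[OF A'] by auto
    next
      case False
      then have "A = Suc ` A'" using eq by blast
      then show ?thesis using A A' by (auto simp: card_image)
    qed
  qed (auto simp: ins card_image)
  moreover have "image Suc ` ?X \<inter> (\<lambda>A. insert 0 (Suc ` A)) ` ?Y = {}" by auto
  moreover have "inj_on (image Suc) ?X" by (auto simp: inj_on_def inj_image_eq_iff)
  moreover have "inj_on (\<lambda>A. insert 0 (Suc ` A)) ?Y"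
  proof (rule inj_onI)
    fix A A' assume "insert 0 (Suc ` A) = insert 0 (Suc ` A')"
    then have "Suc ` A = Suc ` A'" by (auto simp: set_eq_iff)
    then show "A = A'" by (simp add: inj_image_eq_iff)
  qed
  ultimately show ?thesis using fin by (simp add: sum.union_disjoint sum.reindex)
qed

lemma insertion_sum_subsets:
  "(\<Sum>A | A \<subseteq> {..<n} \<and> card A = length ys.
      \<Phi> (map (\<lambda>i. if i \<in> A then ys ! card {j\<in>A. j < i} else u) [0..<n])) = insertion_sum u n ys \<Phi>"
proof (induction n arbitrary: ys \<Phi>)
  case 0
  have "{A :: nat set. A = {} \<and> card A = length ys} = (if ys = [] then {{}} else {})" by auto
  then show ?case by simp
next
  case (Suc n)
  let ?l = "\<lambda>n ys A. map (\<lambda>i. if i \<in> A then ys ! card {j\<in>A. j < i} else u) [0..<n]"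
  have upt: "[0..<Suc n] = 0 # map Suc [0..<n]"
    by (simp add: upt_conv_Cons map_Suc_upt del: upt_Suc)
  \<comment> \<open>A shift keeps the rank of a position in \<open>A\<close>; adding 0 to
    \<open>A\<close> raises every rank by one, which skips the head of the list.\<close>
  have below: "{j \<in> Suc ` A. j < Suc i} = Suc ` {j \<in> A. j < i}"
    "{j. (j = 0 \<or> j \<in> Suc ` A) \<and> j < Suc i} = insert 0 (Suc ` {j \<in> A. j < i})" for A :: "nat set" and i
    by auto
  have 1: "?l (Suc n) zs (Suc ` A) = u # ?l n zs A" for A zs
    unfolding upt by (auto simp: below card_image)
  have 2: "?l (Suc n) (y # ys') (insert 0 (Suc ` A)) = y # ?l n ys' A" for A y ys'
    unfolding upt by (auto simp: below card_image card_insert_if)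
  show ?case
  proof (cases ys)
    case Nil
    show ?thesis unfolding Nil by (simp add: sum_subsets_Suc 1[where zs = "[]"] Suc.IH[symmetric] del: upt_Suc)
  next
    case (Cons y ys')
    show ?thesis unfolding Cons sum_subsets_Suc 1 2
      by (simp add: Suc.IH[symmetric] del: upt_Suc)
  qed
qed

text \<open>Every list in the sum has length \<open>n\<close> and contains all entries of
  \<open>ys\<close>, so only these values of \<open>\<Phi>\<close> count.\<close>

lemma insertion_sum_eq_0:
  "(\<And>zs. length zs = n \<Longrightarrow> set ys \<subseteq> set zs \<Longrightarrow> \<Phi> zs = 0) \<Longrightarrow> insertion_sum u n ys \<Phi> = 0"
proof (induction n arbitrary: ys \<Phi>)
  case (Suc n)
  have "insertion_sum u n ys (\<lambda>zs. \<Phi> (u # zs)) = 0"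
    by (rule Suc.IH) (auto intro!: Suc.prems)
  moreover have "insertion_sum u n ys' (\<lambda>zs. \<Phi> (y # zs)) = 0" if "ys = y # ys'" for y ys'
    using that by (intro Suc.IH) (auto intro!: Suc.prems)
  ultimately show ?case by (auto split: list.split)
qed simp

lemma insertion_sum_long: "n < length ys \<Longrightarrow> insertion_sum u n ys \<Phi> = 0"
  by (induction n arbitrary: ys \<Phi>) (auto split: list.split)

lemma sum_fun_apply: "(\<Sum>a\<in>A. g a) x = (\<Sum>a\<in>A. g a x)"
  by (induction A rule: infinite_finite_induct) auto

section \<open>Multilinear functions on an operad\<close>

locale fin_operad = operad P for P :: "('k::field_char_0, 'p::ab_group_add) operad_data" +
  assumes ops_0: "ops P 0 = {0}"
    and fin_dim: "\<exists>B. finite B \<and> ops P n = module.span (smul P) B"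
begin

sublocale V: vector_space "smul P"
  by (rule vector_space)

lemma operad: "operad P"
  by unfold_locales

definition lin :: "('p \<Rightarrow> 'k) \<Rightarrow> bool" where
  "lin f \<longleftrightarrow> (\<forall>x y. f (x + y) = f x + f y) \<and> (\<forall>c x. f (smul P c x) = c * f x)"

lemma lin_iff_linear: "lin f \<longleftrightarrow> Vector_Spaces.linear (smul P) (*) f"
proof -
  have "vector_space ((*) :: 'k \<Rightarrow> 'k \<Rightarrow> 'k)" by unfold_locales (auto simp: algebra_simps)
  then show ?thesis
    by (simp add: lin_def Vector_Spaces.linear_iff vector_space)
qed

lemma lin_add: "lin f \<Longrightarrow> f (x + y) = f x + f y"
  and lin_scale: "lin f \<Longrightarrow> f (smul P c x) = c * f x"
  by (simp_all add: lin_def)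

lemma lin_0: "lin f \<Longrightarrow> f 0 = 0"
  using lin_scale[of f 0 0] by simp

lemma lin_diff: "lin f \<Longrightarrow> f (x - y) = f x - f y"
  using lin_add[of f "x - y" y] by simp

lemma lin_sum: "lin f \<Longrightarrow> f (\<Sum>a\<in>A. g a) = (\<Sum>a\<in>A. f (g a))"
  by (induction A rule: infinite_finite_induct) (simp_all add: lin_add lin_0)

lemma lin_zero_fun: "lin (\<lambda>x. 0)"
  by (simp add: lin_def)

lemma lin_plus_fun: "lin f \<Longrightarrow> lin g \<Longrightarrow> lin (\<lambda>x. f x + g x)"
  by (simp add: lin_def algebra_simps)

lemma lin_sum_fun: "(\<And>a. a \<in> A \<Longrightarrow> lin (f a)) \<Longrightarrow> lin (\<lambda>x. \<Sum>a\<in>A. f a x)"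
  by (induction A rule: infinite_finite_induct) (auto intro: lin_zero_fun lin_plus_fun)

lemma dual_iff: "f \<in> dual P \<longleftrightarrow> lin f \<and> finite {n. \<exists>x\<in>ops P n. f x \<noteq> 0}"
  by (simp add: dual_def lin_iff_linear)

lemma dual_basis_lin: "b \<in> dual_basis P \<Longrightarrow> lin b"
  using dual_basis(1)[OF operad] dual_iff by blast

lemma dual_bound:
  assumes "f \<in> dual P"
  obtains N where "\<And>n x. N < n \<Longrightarrow> x \<in> ops P n \<Longrightarrow> f x = 0"
proof -
  have "finite {n. \<exists>x\<in>ops P n. f x \<noteq> 0}" using assms by (simp add: dual_iff)
  then obtain N where "\<forall>n\<in>{n. \<exists>x\<in>ops P n. f x \<noteq> 0}. n \<le> N"
    unfolding finite_nat_set_iff_bounded_le ..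
  then show ?thesis by (intro that[of N]) force
qed

text \<open>Homogeneous component: the projection of P onto P(n). As the chosen basis of the dual
  may mix degrees, degrees are read off in P itself.\<close>

definition hc :: "nat \<Rightarrow> 'p \<Rightarrow> 'p" where
  "hc n x = (THE c. (\<forall>n. c n \<in> ops P n) \<and> finite {n. c n \<noteq> 0} \<and> x = (\<Sum>n | c n \<noteq> 0. c n)) n"

lemma hc: "hc n x \<in> ops P n" "finite {n. hc n x \<noteq> 0}" "(\<Sum>n | hc n x \<noteq> 0. hc n x) = x"
  using theI'[OF direct_sum[of x]] unfolding hc_def by auto

lemma sum_hc: "finite A \<Longrightarrow> (\<And>n. n \<notin> A \<Longrightarrow> hc n x = 0) \<Longrightarrow> (\<Sum>n\<in>A. hc n x) = x"
  using hc(3)[of x] by (subst (asm) sum.mono_neutral_left[of A]) auto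

lemma hc_unique:
  assumes c: "\<And>n. c n \<in> ops P n" and A: "finite A" "\<And>n. n \<notin> A \<Longrightarrow> c n = 0"
    and x: "x = (\<Sum>n\<in>A. c n)"
  shows "hc n x = c n"
proof -
  define Q where "Q c \<longleftrightarrow> (\<forall>n. c n \<in> ops P n) \<and> finite {n. c n \<noteq> 0} \<and> x = (\<Sum>n | c n \<noteq> 0. c n)" for c
  have sub: "{n. c n \<noteq> 0} \<subseteq> A" using A(2) by blast
  then have "x = (\<Sum>n | c n \<noteq> 0. c n)" unfolding x using A by (intro sum.mono_neutral_right) auto
  then have "Q c" unfolding Q_def using c sub A(1) finite_subset by blast
  moreover have "\<exists>!c. Q c" unfolding Q_def by (rule direct_sum)
  ultimately have "(THE c. Q c) = c" by (rule the1_equality[rotated])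
  then show ?thesis by (simp add: hc_def Q_def)
qed

lemma hc_add: "hc n (x + y) = hc n x + hc n y"
proof (rule hc_unique)
  let ?A = "{n. hc n x \<noteq> 0} \<union> {n. hc n y \<noteq> 0}"
  show A: "finite ?A" using hc(2) by blast
  have "(\<Sum>n\<in>?A. hc n x) = x" "(\<Sum>n\<in>?A. hc n y) = y"
    by (rule sum_hc[OF A], simp)+
  then show "x + y = (\<Sum>n\<in>?A. hc n x + hc n y)" by (simp add: sum.distrib)
qed (auto intro: V.subspace_add[OF subspace_ops] hc(1))

lemma hc_scale: "hc n (smul P c x) = smul P c (hc n x)"
proof (rule hc_unique)
  let ?A = "{n. hc n x \<noteq> 0}"
  show "finite ?A" by (rule hc(2))
  then show "smul P c x = (\<Sum>n\<in>?A. smul P c (hc n x))"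
    by (simp add: V.scale_sum_right[symmetric] hc(3))
qed (auto intro: V.subspace_scale[OF subspace_ops] hc(1))

lemma hc_ops: "x \<in> ops P m \<Longrightarrow> hc n x = (if n = m then x else 0)"
  by (rule hc_unique[where A = "{m}"]) (auto intro: V.subspace_0[OF subspace_ops])

lemma hc_ops_0: "hc 0 x = 0"
  using hc(1)[of 0 x] by (simp add: ops_0)

lemma opcomp_zero_left: "opcomp P 0 xs = 0"
  using opcomp_smul_left[of 0 xs 0] V.subspace_0[OF subspace_ops] by simp

text \<open>Linearity in the left argument is an axiom only within one arity; \<open>hc\<close>
  selects the matching one and so extends composition linearly to all of P.\<close>

lemma lin_opcomp_hc: "lin f \<Longrightarrow> lin (\<lambda>q. f (opcomp P (hc (length xs) q) xs))"
  by (simp add: lin_def hc_add hc_scale opcomp_add_left opcomp_smul_left hc(1))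

section \<open>Expansions of multilinear functions\<close>

definition multilin :: "nat \<Rightarrow> ('p list \<Rightarrow> 'k) \<Rightarrow> bool" where
  "multilin n \<Phi> \<longleftrightarrow> (\<forall>as bs. length as + Suc (length bs) = n \<longrightarrow> lin (\<lambda>x. \<Phi> (as @ x # bs)))"

lemma multilin_head: "multilin (Suc n) \<Phi> \<Longrightarrow> length xs = n \<Longrightarrow> lin (\<lambda>x. \<Phi> (x # xs))"
  unfolding multilin_def by (auto dest: spec[of _ "[]"])

lemma multilin_tail: "multilin (Suc n) \<Phi> \<Longrightarrow> multilin n (\<lambda>xs. \<Phi> (x # xs))"
  unfolding multilin_def
proof (intro allI impI)
  fix as bs :: "'p list"
  assume "\<forall>as bs. length as + Suc (length bs) = Suc n \<longrightarrow> lin (\<lambda>y. \<Phi> (as @ y # bs))"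
    and "length as + Suc (length bs) = n"
  from this(1)[rule_format, of "x # as" bs] this(2)
  show "lin (\<lambda>y. \<Phi> (x # as @ y # bs))" by simp
qed

lemma multilin_SucI:
  assumes "\<And>xs. length xs = n \<Longrightarrow> lin (\<lambda>x. \<Phi> (x # xs))" "\<And>x. multilin n (\<lambda>xs. \<Phi> (x # xs))"
  shows "multilin (Suc n) \<Phi>"
  unfolding multilin_def
proof (intro allI impI)
  fix as bs :: "'p list" assume len: "length as + Suc (length bs) = Suc n"
  show "lin (\<lambda>x. \<Phi> (as @ x # bs))"
  proof (cases as)
    case Nil
    then show ?thesis using assms(1) len by simp
  next
    case (Cons a as')
    then show ?thesis using assms(2)[of a] len by (simp add: multilin_def)
  qed
qed

lemma multilin_sum_fun:
  "(\<And>a. a \<in> A \<Longrightarrow> multilin n (\<Phi> a)) \<Longrightarrow> multilin n (\<lambda>xs. \<Sum>a\<in>A. \<Phi> a xs)"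
  unfolding multilin_def by (auto intro: lin_sum_fun)

lemma multilin_opcomp: "q \<in> ops P n \<Longrightarrow> lin f \<Longrightarrow> multilin n (\<lambda>xs. f (opcomp P q xs))"
  unfolding multilin_def by (auto simp: lin_def opcomp_add_right opcomp_smul_right)

lemma multilin_eq_0: "multilin (length xs) \<Phi> \<Longrightarrow> 0 \<in> set xs \<Longrightarrow> \<Phi> xs = 0"
proof -
  assume \<Phi>: "multilin (length xs) \<Phi>" and "0 \<in> set xs"
  then obtain as bs where xs: "xs = as @ 0 # bs" by (auto dest: split_list)
  with \<Phi> have "lin (\<lambda>x. \<Phi> (as @ x # bs))" by (simp add: multilin_def)
  then show "\<Phi> xs = 0" unfolding xs by (rule lin_0)
qed

text \<open>\<open>g\<close> may depend on the entry, but a common \<open>K\<close> makes the index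
  tuples words over one set.\<close>

lemma multilin_expand:
  assumes "multilin (length xs) \<Phi>" "finite K" "\<And>x. x \<in> set xs \<Longrightarrow> x = (\<Sum>k\<in>K. g x k)"
  shows "\<Phi> xs = (\<Sum>ks\<in>words K (length xs). \<Phi> (map2 g xs ks))"
  using assms(1,3)
proof (induction xs arbitrary: \<Phi>)
  case Nil
  have "{ks. set ks \<subseteq> K \<and> ks = []} = {[]}" by auto
  then show ?case by simp
next
  case (Cons x xs)
  have "\<Phi> (x # xs) = (\<Sum>k\<in>K. \<Phi> (g x k # xs))"
    using Cons.prems(2)[of x] lin_sum[OF multilin_head[OF Cons.prems(1)[simplified] refl], of "g x" K]
    by simp
  also have "\<dots> = (\<Sum>k\<in>K. \<Sum>ks\<in>words K (length xs). \<Phi> (g x k # map2 g xs ks))"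
    using Cons.prems by (intro sum.cong refl Cons.IH multilin_tail) auto
  finally show ?case by (simp add: sum_words_Suc)
qed

lemma multilin_expand_replicate:
  assumes "multilin n \<Phi>" "finite K" "y = (\<Sum>k\<in>K. g k)"
  shows "\<Phi> (replicate n y) = (\<Sum>ks\<in>words K n. \<Phi> (map g ks))"
proof -
  have "map2 (\<lambda>_. g) (replicate (length ks) y) ks = map g ks" for ks
    by (induction ks) auto
  then have map2: "map2 (\<lambda>_. g) (replicate n y) ks = map g ks" if "ks \<in> words K n" for ks
    using that by blast
  have "\<Phi> (replicate n y) = (\<Sum>ks\<in>words K n. \<Phi> (map2 (\<lambda>_. g) (replicate n y) ks))"
    by (rule multilin_expand[of "replicate n y", unfolded length_replicate, OF assms(1,2)])
      (auto simp: assms(3)[symmetric] split: if_splits)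
  also have "\<dots> = (\<Sum>ks\<in>words K n. \<Phi> (map g ks))"
    by (intro sum.cong refl arg_cong[of _ _ \<Phi>] map2)
  finally show ?thesis .
qed

lemma dual_vector_coordinate:
  assumes "finite F" "b \<in> F" "lin b" "\<And>b'. b' \<in> F \<Longrightarrow> b (e b') = (if b' = b then 1 else 0)"
  shows "b (\<Sum>b'\<in>F. smul P (c b') (e b')) = c b"
proof -
  have "b (\<Sum>b'\<in>F. smul P (c b') (e b')) = (\<Sum>b'\<in>F. c b' * b (e b'))"
    by (simp only: lin_sum[OF assms(3)] lin_scale[OF assms(3)])
  also have "\<dots> = (\<Sum>b'\<in>F. if b' = b then c b' else 0)"
    by (rule sum.cong) (simp_all add: assms(4))
  finally show ?thesis using assms(1,2) by simp
qed

text \<open>The vectors \<open>e b\<close> give back an entry only up to a vector killed by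
  \<open>F\<close>. The last hypothesis makes such vectors negligible: \<open>\<Phi>\<close> factors
  through the finite-dimensional quotient on which \<open>F\<close> is a basis of the dual.\<close>

lemma multilin_expand_dual:
  assumes F: "finite F" "\<And>b. b \<in> F \<Longrightarrow> lin b"
    and e: "\<And>b b'. b \<in> F \<Longrightarrow> b' \<in> F \<Longrightarrow> b' (e b) = (if b = b' then 1 else 0)"
    and \<Phi>: "multilin (length xs) \<Phi>"
      "\<And>as x bs. length as + Suc (length bs) = length xs \<Longrightarrow> \<forall>b\<in>F. b x = 0 \<Longrightarrow> \<Phi> (as @ x # bs) = 0"
  shows "\<Phi> xs = (\<Sum>bs\<in>words F (length xs). word_pairing bs xs * \<Phi> (map e bs))"
  using \<Phi>
proof (induction xs arbitrary: \<Phi>)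
  case Nil
  have "{bs. set bs \<subseteq> F \<and> bs = []} = {[]}" by auto
  then show ?case by simp
next
  case (Cons x xs)
  note head = multilin_head[OF Cons.prems(1)[simplified] refl]
  \<comment> \<open>Every functional in \<open>F\<close> agrees on \<open>x\<close> and
    \<open>?p\<close>, so as first entries they are not distinguished by
    \<open>\<Phi>\<close>.\<close>
  let ?p = "\<Sum>b\<in>F. smul P (b x) (e b)"
  have "b (x - ?p) = 0" if "b \<in> F" for b
    using F that e dual_vector_coordinate[of F b e "\<lambda>b. b x"] by (simp add: lin_diff)
  then have "\<Phi> ((x - ?p) # xs) = 0" using Cons.prems(2)[of "[]" xs "x - ?p"] by simp
  then have "\<Phi> (x # xs) = \<Phi> (?p # xs)" by (simp add: lin_diff[OF head])
  also have "\<dots> = (\<Sum>b\<in>F. b x * \<Phi> (e b # xs))"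
    by (simp add: lin_sum[OF head] lin_scale[OF head])
  also have "\<dots> = (\<Sum>b\<in>F. b x * (\<Sum>bs\<in>words F (length xs). word_pairing bs xs * \<Phi> (e b # map e bs)))"
  proof (intro sum.cong refl arg_cong2[of _ _ _ _ "(*)"] Cons.IH)
    fix b and as bs :: "'p list" and y assume "length as + Suc (length bs) = length xs" "\<forall>b\<in>F. b y = 0"
    then show "\<Phi> (e b # as @ y # bs) = 0" using Cons.prems(2)[of "e b # as" bs y] by simp
  qed (use Cons.prems(1) in \<open>simp add: multilin_tail\<close>)
  finally show ?case by (simp add: sum_words_Suc sum_distrib_left mult.assoc)
qed

section \<open>Insertions into multilinear functions\<close>

lemma insertion_sum_lin:
  "(\<And>zs. length zs = n \<Longrightarrow> lin (\<lambda>x. \<Psi> x zs)) \<Longrightarrow> lin (\<lambda>x. insertion_sum u n ys (\<Psi> x))"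
proof (induction n arbitrary: ys \<Psi>)
  case (Suc n)
  have "lin (\<lambda>x. insertion_sum u n ys' (\<lambda>zs. \<Psi> x (y # zs)))" for y ys'
    by (rule Suc.IH) (simp add: Suc.prems)
  then show ?case by (cases ys) (auto intro: lin_plus_fun lin_zero_fun)
next
  case 0
  then show ?case by (cases "ys = []") (auto intro: lin_zero_fun)
qed

lemma insertion_sum_multilin:
  "multilin n \<Phi> \<Longrightarrow> multilin k (\<lambda>ys. insertion_sum u n ys \<Phi>)"
proof (induction n arbitrary: \<Phi> k)
  case 0
  show ?case by (auto simp: multilin_def intro: lin_zero_fun)
next
  case (Suc n)
  show ?case
    unfolding multilin_def
  proof (intro allI impI)
    fix as bs :: "'p list" assume "length as + Suc (length bs) = k"
    have 1: "lin (\<lambda>x. insertion_sum u n (as' @ x # bs) (\<lambda>zs. \<Phi> (v # zs)))" for as' v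
      using Suc.IH[OF multilin_tail[OF Suc.prems], of "length as' + Suc (length bs)"]
      by (simp add: multilin_def)
    have 2: "lin (\<lambda>x. insertion_sum u n bs (\<lambda>zs. \<Phi> (x # zs)))"
      by (intro insertion_sum_lin multilin_head[OF Suc.prems])
    show "lin (\<lambda>x. insertion_sum u (Suc n) (as @ x # bs) \<Phi>)"
    proof (cases as)
      case Nil
      then show ?thesis using lin_plus_fun[OF 1[of "[]" u] 2] by simp
    next
      case (Cons a as')
      then show ?thesis using lin_plus_fun[OF 1[of as u] 1[of as' a]] by simp
    qed
  qed
qed

text \<open>Expanding \<open>\<Phi> (replicate n (u + y))\<close> gives all lists of copies of
  \<open>u\<close> and \<open>y\<close>, here grouped by the number \<open>s\<close> of copies of
  \<open>y\<close>; terms with \<open>s > n\<close> are zero. With \<open>u\<close> the operadic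
  unit, this turns brackets into composition at \<open>I + y\<close>.\<close>

lemma insertion_sum_replicate:
  "multilin n \<Phi> \<Longrightarrow> n \<le> N \<Longrightarrow> (\<Sum>s\<le>N. insertion_sum u n (replicate s y) \<Phi>) = \<Phi> (replicate n (u + y))"
proof (induction n arbitrary: \<Phi> N)
  case 0
  have "(\<Sum>s\<le>N. insertion_sum u 0 (replicate s y) \<Phi>) = (\<Sum>s\<le>N. if s = 0 then \<Phi> [] else 0)"
    by (intro sum.cong) auto
  then show ?case by simp
next
  case (Suc n)
  from Suc.prems(2) obtain N' where N: "N = Suc N'" "n \<le> N'" by (cases N) auto
  \<comment> \<open>The term \<open>s = 0\<close> is the empty case and every other one loses a
    \<open>y\<close>, hence the bound \<open>N'\<close>.\<close>
  have "(\<Sum>s\<le>N. case replicate s y of [] \<Rightarrow> 0 | z # ys \<Rightarrow> insertion_sum u n ys (\<lambda>zs. \<Phi> (z # zs)))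
      = (\<Sum>s\<le>N'. insertion_sum u n (replicate s y) (\<lambda>zs. \<Phi> (y # zs)))"
    unfolding N(1) by (simp add: sum.atMost_Suc_shift del: sum.atMost_Suc)
  then have "(\<Sum>s\<le>N. insertion_sum u (Suc n) (replicate s y) \<Phi>)
      = (\<Sum>s\<le>N. insertion_sum u n (replicate s y) (\<lambda>zs. \<Phi> (u # zs)))
        + (\<Sum>s\<le>N'. insertion_sum u n (replicate s y) (\<lambda>zs. \<Phi> (y # zs)))"
    by (simp add: sum.distrib del: sum.atMost_Suc)
  also have "\<dots> = \<Phi> (u # replicate n (u + y)) + \<Phi> (y # replicate n (u + y))"
    using Suc.prems(2) N(2) by (simp add: Suc.IH multilin_tail[OF Suc.prems(1)])
  also have "\<dots> = \<Phi> (replicate (Suc n) (u + y))"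
    using lin_add[OF multilin_head[OF Suc.prems(1), of "replicate n (u + y)"]] by simp
  finally show ?case .
qed

text \<open>As in Gram-Schmidt: by independence the new functional \<open>f\<close> differs at some
  \<open>x\<close> from the combination of \<open>F\<close> with the same values on the
  \<open>e b\<close>. Removing the \<open>e b\<close> parts from \<open>x\<close> and normalizing
  gives a vector \<open>y\<close> dual to \<open>f\<close>.\<close>

lemma dual_vectors:
  assumes "finite F" "F \<subseteq> dual_basis P"
  shows "\<exists>e. \<forall>b\<in>F. \<forall>b'\<in>F. b' (e b) = (if b = b' then 1 else 0)"
  using assms
proof (induction F)
  case (insert f F)
  then obtain e where e: "\<And>b b'. b \<in> F \<Longrightarrow> b' \<in> F \<Longrightarrow> b' (e b) = (if b = b' then 1 else 0)"
    by auto
  have lin: "lin b" if "b \<in> insert f F" for b using that insert.prems dual_basis_lin by blast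
  have "fn.independent (insert f F)"
    using dual_basis(2)[OF operad] insert.prems by (rule fn.independent_mono)
  then have "f \<notin> fn.span F" using insert.hyps by (simp add: fn.independent_insert)
  moreover have "(\<Sum>b\<in>F. fscale (f (e b)) b) \<in> fn.span F"
    by (intro fn.span_sum fn.span_scale fn.span_base)
  ultimately have "f \<noteq> (\<Sum>b\<in>F. fscale (f (e b)) b)" by auto
  then obtain x where x: "f x \<noteq> (\<Sum>b\<in>F. f (e b) * b x)"
    by (auto simp: fun_eq_iff sum_fun_apply fscale_def)
  define d where "d = f x - (\<Sum>b\<in>F. f (e b) * b x)"
  define y where "y = smul P (1 / d) (x - (\<Sum>b\<in>F. smul P (b x) (e b)))"
  have d: "d \<noteq> 0" using x by (simp add: d_def)
  have f: "lin f" by (simp add: lin)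
  have "f (x - (\<Sum>b\<in>F. smul P (b x) (e b))) = d"
    by (simp only: lin_diff[OF f] lin_sum[OF f] lin_scale[OF f] d_def mult.commute)
  then have fy: "f y = 1"
    using d by (simp add: y_def lin_scale[OF f])
  have by0: "b y = 0" if "b \<in> F" for b
  proof -
    have b: "lin b" using that by (simp add: lin)
    have "b (\<Sum>b\<in>F. smul P (b x) (e b)) = b x"
      by (rule dual_vector_coordinate[OF insert.hyps(1) that b e[OF _ that]])
    then show ?thesis by (simp add: y_def lin_scale[OF b] lin_diff[OF b])
  qed
  \<comment> \<open>The old vectors are corrected by a multiple of \<open>y\<close>, on which all of
    \<open>F\<close> vanishes, so that \<open>f\<close> vanishes on them.\<close>
  let ?e = "\<lambda>b. if b = f then y else e b - smul P (f (e b)) y"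
  have e_f: "b' (?e f) = (if f = b' then 1 else 0)" if "b' \<in> insert f F" for b'
    using that fy by0 insert.hyps(2) by auto
  have e_F: "b' (?e b) = (if b = b' then 1 else 0)" if "b \<in> F" "b' \<in> insert f F" for b b'
  proof -
    have "b \<noteq> f" using that(1) insert.hyps(2) by auto
    then have "b' (?e b) = b' (e b) - f (e b) * b' y"
      using lin[OF that(2)] by (simp add: lin_diff lin_scale)
    then show ?thesis
      using that e by0 fy \<open>b \<noteq> f\<close> by (cases "b' = f") simp_all
  qed
  show ?case using e_f e_F by (intro exI[of _ ?e]) blast
qed simp

lemma separating_S: "separating (S_mons P) (mon :: 'p \<Rightarrow> _)"
  unfolding S_mons_def
proof (rule separating_mon)
  fix F and c :: "('p \<Rightarrow> 'k) \<Rightarrow> 'k" assume F: "finite F" "F \<subseteq> dual_basis P"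
  from dual_vectors[OF F] obtain e
    where e: "\<forall>b\<in>F. \<forall>b'\<in>F. b' (e b) = (if b = b' then 1 else 0)" ..
  have "b (\<Sum>b\<in>F. smul P (c b) (e b)) = c b" if "b \<in> F" for b
  proof (rule dual_vector_coordinate[OF F(1) that])
    show "lin b" using that F(2) by (blast intro: dual_basis_lin)
    show "b (e b') = (if b' = b then 1 else 0)" if "b' \<in> F" for b'
      using e that \<open>b \<in> F\<close> by blast
  qed
  then show "\<exists>x. \<forall>b\<in>F. b x = c b" by blast
qed

lemma separating_words: "separating (lists (dual_basis P)) (\<lambda>xs fs. word_pairing fs xs)"
  unfolding separating_def
proof (intro ballI impI)
  fix u :: "('p \<Rightarrow> 'k) list \<Rightarrow>\<^sub>0 'k"
  assume u: "u \<in> lincomb (lists (dual_basis P))" and 0: "\<forall>xs. ev (\<lambda>fs. word_pairing fs xs) u = 0"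
  let ?F = "\<Union>fs\<in>Poly_Mapping.keys u. set fs"
  have F: "finite ?F" "?F \<subseteq> dual_basis P" using u by (auto simp: lincomb_def)
  from dual_vectors[OF F] obtain e
    where e: "\<forall>b\<in>?F. \<forall>b'\<in>?F. b' (e b) = (if b = b' then 1 else 0)" ..
  \<comment> \<open>Words in dual vectors are dual to words in \<open>?F\<close>, so pairing with
    \<open>map e fs\<close> reads off the coefficient of \<open>fs\<close>.\<close>
  have wp: "word_pairing gs (map e fs) = (if gs = fs then 1 else 0)"
    if "set fs \<subseteq> ?F" "set gs \<subseteq> ?F" for fs gs
    using that
  proof (induction gs arbitrary: fs)
    case (Cons g gs)
    show ?case
    proof (cases fs)
      case fs: (Cons f fs')
      have "f \<in> ?F" "g \<in> ?F" using Cons.prems unfolding fs by simp_all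
      with e have "g (e f) = (if f = g then 1 else 0)" by blast
      then show ?thesis using Cons fs by simp
    qed simp
  qed auto
  have "Poly_Mapping.lookup u fs = 0" if fs: "fs \<in> Poly_Mapping.keys u" for fs
  proof -
    have "ev (\<lambda>gs. word_pairing gs (map e fs)) u
        = (\<Sum>gs\<in>Poly_Mapping.keys u. if gs = fs then Poly_Mapping.lookup u gs else 0)"
      unfolding ev_def using fs by (intro sum.cong refl) (subst wp, auto)
    with 0 fs show ?thesis by simp
  qed
  then show "u = 0" by (intro poly_mapping_eqI) (auto simp: in_keys_iff)
qed

text \<open>The coordinates of \<open>hc n x\<close> in a finite basis of P(n) belong to the graded
  dual, and each is a finite combination of elements of \<open>dual_basis P\<close>. The basis
  elements used for \<open>n \<le> N\<close> form \<open>F\<close>; they may mix degrees.\<close>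

lemma dual_basis_detects:
  "\<exists>F. finite F \<and> F \<subseteq> dual_basis P \<and> (\<forall>x. (\<forall>b\<in>F. b x = 0) \<longrightarrow> (\<forall>n\<le>N. hc n x = 0))"
proof -
  have "\<exists>F. finite F \<and> F \<subseteq> dual_basis P \<and> (\<forall>x. (\<forall>b\<in>F. b x = 0) \<longrightarrow> hc n x = 0)" for n
  proof -
    obtain E0 where E0: "finite E0" "ops P n = V.span E0" using fin_dim by blast
    obtain E where E: "E \<subseteq> E0" "V.independent E" "E0 \<subseteq> V.span E"
      by (rule V.maximal_independent_subset)
    have "V.span E0 \<subseteq> V.span E" using E(3) by (rule V.span_minimal) (rule V.subspace_span)
    then have in_span: "hc n x \<in> V.span E" for x using hc(1)[of n x] E0(2) by blast
    define r where "r e x = V.representation E (hc n x) e" for e x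
    let ?R = "\<lambda>e. fn.representation (dual_basis P) (r e)"
    have r_dual: "r e \<in> dual P" for e
    proof -
      have "lin (r e)"
        unfolding lin_def r_def hc_add hc_scale
        by (simp add: V.representation_add V.representation_scale E(2) in_span)
      moreover have "{m. \<exists>x\<in>ops P m. r e x \<noteq> 0} \<subseteq> {n}"
        by (auto simp: r_def hc_ops V.representation_zero split: if_splits)
      ultimately show ?thesis by (auto simp: dual_iff intro: finite_subset)
    qed
    let ?F = "\<Union>e\<in>E. {b. ?R e b \<noteq> 0}"
    have "finite ?F" using E(1) E0(1) finite_subset by (auto intro: fn.finite_representation)
    moreover have "?F \<subseteq> dual_basis P" by (auto dest: fn.representation_ne_zero)
    moreover have "hc n x = 0" if "\<forall>b\<in>?F. b x = 0" for x
    proof -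
      have "r e x = 0" if "e \<in> E" for e
      proof -
        have "(\<Sum>b | ?R e b \<noteq> 0. fscale (?R e b) b) = r e"
          using dual_basis(2,3)[OF operad] r_dual by (intro fn.sum_nonzero_representation_eq) auto
        then have "r e x = (\<Sum>b | ?R e b \<noteq> 0. ?R e b * b x)"
          by (auto simp: fun_eq_iff sum_fun_apply fscale_def)
        then show ?thesis using \<open>\<forall>b\<in>?F. b x = 0\<close> that by (auto intro!: sum.neutral)
      qed
      then have "{e. V.representation E (hc n x) e \<noteq> 0} = {}"
        by (auto simp: r_def dest: V.representation_ne_zero)
      then show ?thesis
        using V.sum_nonzero_representation_eq[OF E(2) in_span[of x]] by simp
    qed
    ultimately show ?thesis by blast
  qed
  then obtain F where F: "\<And>n. finite (F n)" "\<And>n. F n \<subseteq> dual_basis P"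
    "\<And>n x. \<forall>b\<in>F n. b x = 0 \<Longrightarrow> hc n x = 0" by metis
  have "hc n x = 0" if "\<forall>b\<in>(\<Union>n\<le>N. F n). b x = 0" "n \<le> N" for n x
    using that by (intro F(3)) auto
  moreover have "(\<Union>n\<le>N. F n) \<subseteq> dual_basis P" using F(2) by blast
  ultimately show ?thesis using F(1) by (intro exI[of _ "\<Union>n\<le>N. F n"]) blast
qed

text \<open>This carries identities proved with scalar-valued multilinear functions back to
  P.\<close>

lemma eq_if_dual_basis_eq:
  assumes "\<And>b. b \<in> dual_basis P \<Longrightarrow> b x = b y"
  shows "x = y"
proof -
  have "hc n (x - y) = 0" for n
  proof -
    obtain F where "F \<subseteq> dual_basis P" "\<forall>x. (\<forall>b\<in>F. b x = 0) \<longrightarrow> (\<forall>m\<le>n. hc m x = 0)"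
      using dual_basis_detects by blast
    then show ?thesis using assms by (auto simp: lin_diff dual_basis_lin subset_iff)
  qed
  then show ?thesis using hc(3)[of "x - y"] by simp
qed

text \<open>Since \<open>P(0) = 0\<close>, composition does not lower the degree.\<close>

lemma opcomp_eq_0:
  assumes f: "lin f" "\<And>n x. N < n \<Longrightarrow> x \<in> ops P n \<Longrightarrow> f x = 0"
    and q: "q \<in> ops P (length xs)"
    and xs: "N < length xs \<or> (\<exists>x\<in>set xs. \<forall>n\<le>N. hc n x = 0)"
  shows "f (opcomp P q xs) = 0"
proof -
  let ?K = "\<Union>x\<in>set xs. {n. hc n x \<noteq> 0}" and ?\<Phi> = "\<lambda>xs. f (opcomp P q xs)"
  have \<Phi>: "multilin (length xs) ?\<Phi>" using q f(1) by (rule multilin_opcomp)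
  have K: "finite ?K" by (auto intro: hc(2))
  have "?\<Phi> xs = (\<Sum>ks\<in>words ?K (length xs). ?\<Phi> (map2 (\<lambda>x k. hc k x) xs ks))"
    by (rule multilin_expand[OF \<Phi> K, where g = "\<lambda>x k. hc k x"], rule sum_hc[OF K, symmetric]) auto
  also have "\<dots> = 0"
  proof (rule sum.neutral, rule ballI)
    fix ks assume "ks \<in> words ?K (length xs)"
    then have len: "length ks = length xs" by simp
    let ?ys = "map2 (\<lambda>x k. hc k x) xs ks"
    show "?\<Phi> ?ys = 0"
    proof (cases "0 \<in> set ?ys")
      case True
      then show ?thesis using \<Phi> len by (intro multilin_eq_0[of ?ys]) auto
    next
      case False
      have ne: "hc (ks ! i) (xs ! i) \<noteq> 0" if "i < length xs" for i
      proof -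
        have "?ys ! i \<in> set ?ys" using that len by (intro nth_mem) simp
        moreover have "?ys ! i = hc (ks ! i) (xs ! i)" using that len by simp
        ultimately show ?thesis using False by metis
      qed
      have pos: "1 \<le> k" if "k \<in> set ks" for k
      proof -
        from that obtain i where "i < length xs" "k = ks ! i" by (auto simp: in_set_conv_nth len)
        then have "hc k (xs ! i) \<noteq> 0" using ne by simp
        then show ?thesis by (cases k) (simp_all add: hc_ops_0)
      qed
      \<comment> \<open>All degrees are at least 1, so the total degree is at least the number of
        entries; it is also at least the degree of any single entry.\<close>
      have "length ks \<le> sum_list ks"
        using sum_list_mono[of ks "\<lambda>_. 1" id] pos by (simp add: sum_list_replicate map_replicate_const)
      moreover have "N < sum_list ks" if "x \<in> set xs" "\<forall>n\<le>N. hc n x = 0" for x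
      proof -
        from that(1) obtain i where i: "i < length xs" "x = xs ! i" by (auto simp: in_set_conv_nth)
        then have "N < ks ! i" using ne[of i] that(2) by (auto simp: not_le[symmetric])
        also have "\<dots> \<le> sum_list ks" using i len by (intro member_le_sum_list) auto
        finally show ?thesis .
      qed
      ultimately have "N < sum_list ks" using xs len by auto
      moreover have "opcomp P q ?ys \<in> ops P (sum_list ks)"
        using q len hc(1) by (intro opcomp_in) auto
      ultimately show ?thesis by (rule f(2))
    qed
  qed
  finally show ?thesis .
qed

section \<open>The monoid of points\<close>

text \<open>The monoid whose coordinate bialgebra is \<open>D_star P\<close>.\<close>

definition pcomp :: "'p \<Rightarrow> 'p \<Rightarrow> 'p" where
  "pcomp x y = (\<Sum>n | hc n x \<noteq> 0. opcomp P (hc n x) (replicate n y))"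

lemma pcomp_superset:
  assumes "finite A" "\<And>n. n \<notin> A \<Longrightarrow> hc n x = 0"
  shows "pcomp x y = (\<Sum>n\<in>A. opcomp P (hc n x) (replicate n y))"
  unfolding pcomp_def using assms
  by (intro sum.mono_neutral_left) (auto simp: opcomp_zero_left)

text \<open>Such additivity is particular to the left argument; the right one is repeated
  \<open>n\<close> times in arity \<open>n\<close>. It is what later splits off the unit from
  \<open>x + I\<close>.\<close>

lemma pcomp_add: "pcomp (x + x') y = pcomp x y + pcomp x' y"
proof -
  let ?A = "{n. hc n x \<noteq> 0} \<union> {n. hc n x' \<noteq> 0}"
  have A: "finite ?A" using hc(2) by blast
  have "pcomp z y = (\<Sum>n\<in>?A. opcomp P (hc n z) (replicate n y))" if "z \<in> {x, x', x + x'}" for z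
    using that by (intro pcomp_superset[OF A]) (auto simp: hc_add)
  then have "pcomp (x + x') y = (\<Sum>n\<in>?A. opcomp P (hc n (x + x')) (replicate n y))"
    "pcomp x y = (\<Sum>n\<in>?A. opcomp P (hc n x) (replicate n y))"
    "pcomp x' y = (\<Sum>n\<in>?A. opcomp P (hc n x') (replicate n y))"
    by blast+
  then show ?thesis
    by (simp only: hc_add opcomp_add_left hc(1) length_replicate sum.distrib)
qed

lemma pcomp_smul: "pcomp (smul P c x) y = smul P c (pcomp x y)"
proof -
  let ?A = "{n. hc n x \<noteq> 0}"
  have "pcomp (smul P c x) y = (\<Sum>n\<in>?A. opcomp P (hc n (smul P c x)) (replicate n y))"
    using hc(2) by (intro pcomp_superset) (auto simp: hc_scale)
  then show ?thesis
    by (simp add: hc_scale opcomp_smul_left hc(1) V.scale_sum_right pcomp_def)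
qed

lemma lin_pcomp: "lin f \<Longrightarrow> lin (\<lambda>x. f (pcomp x y))"
  by (simp add: lin_def pcomp_add pcomp_smul)

lemma pcomp_ops: "q \<in> ops P n \<Longrightarrow> pcomp q y = opcomp P q (replicate n y)"
  by (subst pcomp_superset[of "{n}"]) (auto simp: hc_ops)

lemma pcomp_unit_left: "pcomp (opunit P) y = y"
  using pcomp_ops[OF opunit_in] by (simp add: opcomp_unit_left)

lemma pcomp_unit_right: "pcomp x (opunit P) = x"
  by (simp add: pcomp_def opcomp_unit_right hc)

text \<open>The operad axiom concerns homogeneous inner operations, so \<open>y\<close> is expanded
  into components, the axiom is applied to each tuple, and the result is summed up again.
  Functionals come in because the expansions are scalar-valued.\<close>

lemma pcomp_assoc: "pcomp (pcomp x y) z = pcomp x (pcomp y z)"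
proof (rule eq_if_dual_basis_eq)
  fix f assume "f \<in> dual_basis P"
  then have f: "lin f" by (rule dual_basis_lin)
  have homogeneous: "f (pcomp (opcomp P q (replicate n y)) z) = f (opcomp P q (replicate n (pcomp y z)))"
    if q: "q \<in> ops P n" for q n
  proof -
    let ?K = "{k. hc k y \<noteq> 0}"
    have "f (pcomp (opcomp P q (replicate n y)) z)
        = (\<Sum>ks\<in>words ?K n. f (pcomp (opcomp P q (map (\<lambda>k. hc k y) ks)) z))"
      by (rule multilin_expand_replicate[OF multilin_opcomp[OF q lin_pcomp[OF f]]]) (simp_all add: hc)
    also have "\<dots> = (\<Sum>ks\<in>words ?K n. f (opcomp P q (map (\<lambda>k. opcomp P (hc k y) (replicate k z)) ks)))"
    proof (intro sum.cong refl arg_cong[of _ _ f])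
      fix ks assume "ks \<in> words ?K n"
      then have len: "length ks = n" by simp
      let ?rss = "map (\<lambda>k. replicate k z) ks"
      have "opcomp P q (map (\<lambda>k. hc k y) ks) \<in> ops P (sum_list ks)"
        using q len by (intro opcomp_in) (auto simp: hc(1))
      moreover have "concat ?rss = replicate (sum_list ks) z"
        by (induction ks) (auto simp: replicate_add)
      ultimately have "pcomp (opcomp P q (map (\<lambda>k. hc k y) ks)) z
          = opcomp P (opcomp P q (map (\<lambda>k. hc k y) ks)) (concat ?rss)"
        by (simp add: pcomp_ops)
      also have "\<dots> = opcomp P q (map2 (opcomp P) (map (\<lambda>k. hc k y) ks) ?rss)"
        using q len by (intro opcomp_assoc) (auto simp: hc(1))
      also have "map2 (opcomp P) (map (\<lambda>k. hc k y) ks) ?rss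
          = map (\<lambda>k. opcomp P (hc k y) (replicate k z)) ks"
        by (induction ks) auto
      finally show "pcomp (opcomp P q (map (\<lambda>k. hc k y) ks)) z
          = opcomp P q (map (\<lambda>k. opcomp P (hc k y) (replicate k z)) ks)" .
    qed
    also have "\<dots> = f (opcomp P q (replicate n (pcomp y z)))"
      by (rule multilin_expand_replicate[OF multilin_opcomp[OF q f], symmetric])
        (simp_all add: hc pcomp_def)
    finally show ?thesis .
  qed
  have "f (pcomp (pcomp x y) z) = (\<Sum>n | hc n x \<noteq> 0. f (pcomp (opcomp P (hc n x) (replicate n y)) z))"
    unfolding pcomp_def[of x y] by (rule lin_sum[OF lin_pcomp[OF f]])
  also have "\<dots> = f (pcomp x (pcomp y z))"
    unfolding pcomp_def[of x] by (simp add: lin_sum[OF f] homogeneous hc(1))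
  finally show "f (pcomp (pcomp x y) z) = f (pcomp x (pcomp y z))" .
qed

end

section \<open>The two coproducts as functions\<close>

lemma ev_abelianize:
  fixes w :: "('x \<Rightarrow> 'k::comm_ring_1) list \<times> ('x \<Rightarrow> 'k) list \<Rightarrow>\<^sub>0 'k"
  shows "\<exists>L. \<forall>R\<ge>L. \<forall>S\<ge>L. ev (pchar (mon x) (mon y)) (abelianize w)
    = (\<Sum>r\<le>R. \<Sum>s\<le>S. TT_pairing w (replicate r x) (replicate s y))"
proof -
  let ?keys = "Poly_Mapping.keys w"
  have "finite ((\<lambda>(fs, gs). max (length fs) (length gs)) ` ?keys)" by simp
  then obtain L where L: "\<forall>l\<in>(\<lambda>(fs, gs). max (length fs) (length gs)) ` ?keys. l \<le> L"
    unfolding finite_nat_set_iff_bounded_le ..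
  have pairing: "(\<Sum>r\<le>R. word_pairing fs (replicate r z)) = mon z (mset fs)" if "length fs \<le> R"
    for fs :: "('x \<Rightarrow> 'k) list" and R z
  proof -
    have "word_pairing fs (replicate (length fs) z) = mon z (mset fs)"
      by (induction fs) (simp_all add: mon_def)
    then have "word_pairing fs (replicate r z) = (if r = length fs then mon z (mset fs) else 0)" for r
      by (simp add: word_pairing_length)
    then show ?thesis using that by simp
  qed
  have "ev (pchar (mon x) (mon y)) (abelianize w)
      = (\<Sum>r\<le>R. \<Sum>s\<le>S. TT_pairing w (replicate r x) (replicate s y))" if "L \<le> R" "L \<le> S" for R S
  proof -
    have "ev (pchar (mon x) (mon y)) (abelianize w)
        = (\<Sum>p\<in>?keys. Poly_Mapping.lookup w p * (mon x (mset (fst p)) * mon y (mset (snd p))))"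
      unfolding abelianize_def case_prod_unfold ev_sum ev_single pchar_def by simp
    also have "\<dots> = (\<Sum>p\<in>?keys. Poly_Mapping.lookup w p *
        ((\<Sum>r\<le>R. word_pairing (fst p) (replicate r x)) * (\<Sum>s\<le>S. word_pairing (snd p) (replicate s y))))"
    proof (rule sum.cong[OF refl])
      fix p assume "p \<in> ?keys"
      from bspec[OF L imageI[OF this]] have "length (fst p) \<le> L" "length (snd p) \<le> L"
        by (simp_all add: case_prod_unfold)
      then have le: "length (fst p) \<le> R" "length (snd p) \<le> S" using that by simp_all
      show "Poly_Mapping.lookup w p * (mon x (mset (fst p)) * mon y (mset (snd p)))
          = Poly_Mapping.lookup w p * ((\<Sum>r\<le>R. word_pairing (fst p) (replicate r x))
            * (\<Sum>s\<le>S. word_pairing (snd p) (replicate s y)))"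
        unfolding pairing[OF le(1)] pairing[OF le(2)] ..
    qed
    also have "\<dots> = (\<Sum>p\<in>?keys. \<Sum>r\<le>R. \<Sum>s\<le>S. Poly_Mapping.lookup w p *
        (word_pairing (fst p) (replicate r x) * word_pairing (snd p) (replicate s y)))"
      by (subst sum_product) (simp only: sum_distrib_left)
    also have "\<dots> = (\<Sum>r\<le>R. \<Sum>p\<in>?keys. \<Sum>s\<le>S. Poly_Mapping.lookup w p *
        (word_pairing (fst p) (replicate r x) * word_pairing (snd p) (replicate s y)))"
      by (rule sum.swap)
    also have "\<dots> = (\<Sum>r\<le>R. \<Sum>s\<le>S. \<Sum>p\<in>?keys. Poly_Mapping.lookup w p *
        (word_pairing (fst p) (replicate r x) * word_pairing (snd p) (replicate s y)))"
      by (rule sum.cong[OF refl sum.swap])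
    finally show ?thesis unfolding TT_pairing_def case_prod_unfold prod.collapse .
  qed
  then show ?thesis by blast
qed

context fin_operad
begin

abbreviation (input) "\<B> \<equiv> dual_basis P"
abbreviation (input) "I \<equiv> opunit P"

lemma lincomb_abelianize:
  assumes "w \<in> lincomb (lists \<B> \<times> lists \<B>)"
  shows "abelianize w \<in> lincomb (S_mons P \<times> S_mons P)"
  unfolding abelianize_def case_prod_unfold
proof (intro lincomb_sum lincomb_single SigmaI)
  fix p assume "p \<in> Poly_Mapping.keys w"
  then have "fst p \<in> lists \<B>" "snd p \<in> lists \<B>" using assms by (auto simp: lincomb_def)
  then show "mset (fst p) \<in> S_mons P" "mset (snd p) \<in> S_mons P"
    by (simp_all add: S_mons_def in_lists_conv_set subset_iff)
qed

lemma TT_pairing_eqI: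
  assumes "w \<in> lincomb (lists \<B> \<times> lists \<B>)" "w' \<in> lincomb (lists \<B> \<times> lists \<B>)"
    and "\<And>X Y. TT_pairing w X Y = TT_pairing w' X Y"
  shows "w = w'"
proof (rule separatingD[OF separating_Times[OF separating_words separating_words] assms(1,2)])
  fix p :: "'p list \<times> 'p list"
  show "ev (case p of (x, y) \<Rightarrow> pchar (\<lambda>fs. word_pairing fs x) (\<lambda>fs. word_pairing fs y)) w
      = ev (case p of (x, y) \<Rightarrow> pchar (\<lambda>fs. word_pairing fs x) (\<lambda>fs. word_pairing fs y)) w'"
    using assms(3)[of "fst p" "snd p"] by (simp add: TT_pairing_ev case_prod_unfold)
qed

lemma lin_TT_pairing:
  assumes "w \<in> lincomb (lists \<B> \<times> lists \<B>)"
  shows "lin (\<lambda>q. TT_pairing w [q] Y)"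
proof -
  have "lin (\<lambda>q. word_pairing fs [q])" if "fs \<in> lists \<B>" for fs
  proof (cases fs)
    case Nil
    then show ?thesis by (simp add: lin_zero_fun)
  next
    case (Cons f fs')
    then have "lin f" using that by (simp add: dual_basis_lin)
    then show ?thesis using Cons by (simp add: lin_def algebra_simps)
  qed
  moreover have "fst p \<in> lists \<B>" if "p \<in> Poly_Mapping.keys w" for p
    using that assms by (auto simp: lincomb_def)
  ultimately have "lin (\<lambda>q. Poly_Mapping.lookup w p * (word_pairing (fst p) [q] * word_pairing (snd p) Y))"
    if "p \<in> Poly_Mapping.keys w" for p
    using that by (simp add: lin_def algebra_simps)
  then show ?thesis unfolding TT_pairing_def case_prod_unfold by (intro lin_sum_fun) simp
qed

text \<open>Only homogeneous first entries are constrained by the specifications of the coproducts.\<close>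

lemma TT_pairing_eqI_homogeneous:
  assumes w: "w \<in> lincomb (lists \<B> \<times> lists \<B>)" and w': "w' \<in> lincomb (lists \<B> \<times> lists \<B>)"
    and 1: "\<And>n q Y. q \<in> ops P n \<Longrightarrow> TT_pairing w [q] Y = TT_pairing w' [q] Y"
    and 2: "\<And>X Y. length X \<noteq> 1 \<Longrightarrow> TT_pairing w X Y = TT_pairing w' X Y"
  shows "w = w'"
proof (rule TT_pairing_eqI[OF w w'])
  fix X Y
  show "TT_pairing w X Y = TT_pairing w' X Y"
  proof (cases "length X = 1")
    case True
    then obtain q where X: "X = [q]" by (auto simp: length_Suc_conv)
    have "TT_pairing w [\<Sum>n | hc n q \<noteq> 0. hc n q] Y = TT_pairing w' [\<Sum>n | hc n q \<noteq> 0. hc n q] Y"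
      by (simp only: lin_sum[OF lin_TT_pairing[OF w]] lin_sum[OF lin_TT_pairing[OF w']] 1[OF hc(1)])
    then show ?thesis by (simp only: X hc(3))
  qed (rule 2)
qed

abbreviation (input) letters where "letters \<equiv> {[b] | b. b \<in> \<B>}"

lemma letters_lists: "w \<in> lincomb (letters \<times> lists \<B>) \<Longrightarrow> w \<in> lincomb (lists \<B> \<times> lists \<B>)"
  by (force simp: lincomb_def)

lemma TT_pairing_letters:
  assumes "w \<in> lincomb (letters \<times> lists \<B>)" "length X \<noteq> 1"
  shows "TT_pairing w X Y = 0"
proof -
  have "word_pairing (fst p) X = 0" if "p \<in> Poly_Mapping.keys w" for p
    using that assms by (intro word_pairing_length) (auto simp: lincomb_def)
  then show ?thesis by (simp add: TT_pairing_def case_prod_unfold)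
qed

lemma TT_pairing_exists:
  assumes F: "finite F" "F \<subseteq> \<B>"
    and \<Psi>: "\<And>n. multilin (Suc n) \<Psi>"
      "\<And>as x bs. \<forall>b\<in>F. b x = 0 \<Longrightarrow> \<Psi> (as @ x # bs) = 0"
      "\<And>x xs. N < length xs \<Longrightarrow> \<Psi> (x # xs) = 0"
  shows "\<exists>w\<in>lincomb (letters \<times> lists \<B>). \<forall>x Y. TT_pairing w [x] Y = \<Psi> (x # Y)"
proof -
  obtain e where e: "\<forall>b\<in>F. \<forall>b'\<in>F. b' (e b) = (if b = b' then 1 else 0)"
    using dual_vectors[OF F] ..
  have lin_F: "lin b" if "b \<in> F" for b using that F(2) dual_basis_lin by blast
  define w where "w = (\<Sum>b\<in>F. \<Sum>n\<le>N. \<Sum>cs\<in>words F n. Poly_Mapping.single ([b], cs) (\<Psi> (map e (b # cs))))"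
  have "w \<in> lincomb (letters \<times> lists \<B>)"
    unfolding w_def using F(2) by (intro lincomb_sum lincomb_single) auto
  moreover have "TT_pairing w [x] Y = \<Psi> (x # Y)" for x Y
  proof -
    let ?t = "\<lambda>b cs. \<Psi> (map e (b # cs)) * (b x * word_pairing cs Y)"
    have "TT_pairing w [x] Y = (\<Sum>b\<in>F. \<Sum>n\<le>N. \<Sum>cs\<in>words F n. ?t b cs)"
      by (simp add: TT_pairing_ev w_def ev_sum pchar_def)
    also have "\<dots> = (\<Sum>b\<in>F. \<Sum>n\<le>N. if n = length Y then \<Sum>cs\<in>words F (length Y). ?t b cs else 0)"
      by (intro sum.cong refl) (auto simp: word_pairing_length intro!: sum.neutral)
    also have "\<dots> = (if length Y \<le> N then \<Sum>b\<in>F. \<Sum>cs\<in>words F (length Y). ?t b cs else 0)"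
      by simp
    also have "\<dots> = \<Psi> (x # Y)"
    proof (cases "length Y \<le> N")
      case True
      have "\<Psi> (x # Y) = (\<Sum>bs\<in>words F (length (x # Y)). word_pairing bs (x # Y) * \<Psi> (map e bs))"
        using \<Psi>(1)[of "length Y"] \<Psi>(2) e by (intro multilin_expand_dual[OF F(1) lin_F]) auto
      also have "\<dots> = (\<Sum>b\<in>F. \<Sum>cs\<in>words F (length Y). ?t b cs)"
        by (simp add: sum_words_Suc mult_ac)
      finally show ?thesis using True by simp
    qed (simp add: \<Psi>(3))
    finally show ?thesis .
  qed
  ultimately show ?thesis by blast
qed

lemma Delta_star_T:
  assumes b: "b \<in> \<B>"
  shows "Delta_star_T P b \<in> lincomb (letters \<times> lists \<B>)" (is ?in)
    and "TT_pairing (Delta_star_T P b) [q] Y = b (opcomp P (hc (length Y) q) Y)" (is ?pairing)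
proof -
  let ?S = "\<lambda>w. w \<in> lincomb (letters \<times> lists \<B>) \<and>
    (\<forall>p. \<forall>q\<in>ops P p. \<forall>qs. TT_pairing w [q] qs = (if length qs = p then b (opcomp P q qs) else 0))"
  have lin_b: "lin b" using b by (rule dual_basis_lin)
  obtain N where N: "\<And>n x. N < n \<Longrightarrow> x \<in> ops P n \<Longrightarrow> b x = 0"
    using dual_bound[OF subsetD[OF dual_basis(1)[OF operad] b]] by metis
  obtain F where "finite F \<and> F \<subseteq> \<B> \<and> (\<forall>x. (\<forall>b\<in>F. b x = 0) \<longrightarrow> (\<forall>n\<le>N. hc n x = 0))"
    using dual_basis_detects[of N] ..
  then have F: "finite F" "F \<subseteq> \<B>" and Z: "\<And>x n. \<forall>b\<in>F. b x = 0 \<Longrightarrow> n \<le> N \<Longrightarrow> hc n x = 0"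
    by simp_all
  let ?\<Psi> = "\<lambda>xs. case xs of [] \<Rightarrow> 0 | q # qs \<Rightarrow> b (opcomp P (hc (length qs) q) qs)"
  have "\<exists>w\<in>lincomb (letters \<times> lists \<B>). \<forall>x Y. TT_pairing w [x] Y = ?\<Psi> (x # Y)"
  proof (rule TT_pairing_exists[OF F])
    show "multilin (Suc n) ?\<Psi>" for n
    proof (rule multilin_SucI)
      show "lin (\<lambda>x. ?\<Psi> (x # xs))" for xs
        by (simp add: lin_opcomp_hc[OF lin_b])
      show "multilin n (\<lambda>xs. ?\<Psi> (x # xs))" for x
        using multilin_opcomp[OF hc(1) lin_b, of n x] by (simp add: multilin_def)
    qed
    show "?\<Psi> (as @ x # bs) = 0" if x: "\<forall>b\<in>F. b x = 0" for as x bs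
    proof (cases as)
      case Nil
      have "b (opcomp P (hc (length bs) x) bs) = 0"
      proof (cases "length bs \<le> N")
        case True
        then show ?thesis by (simp add: Z[OF x] opcomp_zero_left lin_0[OF lin_b])
      next
        case False
        then show ?thesis by (intro opcomp_eq_0[OF lin_b N]) (auto simp: hc(1))
      qed
      then show ?thesis using Nil by simp
    next
      case (Cons q as')
      have "b (opcomp P (hc (length (as' @ x # bs)) q) (as' @ x # bs)) = 0"
        using Z[OF x] by (intro opcomp_eq_0[OF lin_b N]) (auto simp: hc(1))
      then show ?thesis using Cons by simp
    qed
    show "?\<Psi> (x # xs) = 0" if "N < length xs" for x xs
      using that by (simp, intro opcomp_eq_0[OF lin_b N]) (auto simp: hc(1))
  qed
  then obtain w where w: "w \<in> lincomb (letters \<times> lists \<B>)"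
    "\<And>x Y. TT_pairing w [x] Y = b (opcomp P (hc (length Y) x) Y)" by auto
  have "?S w" using w by (auto simp: hc_ops opcomp_zero_left lin_0[OF lin_b])
  moreover have "w' = w" if "?S w'" for w'
  proof (rule TT_pairing_eqI_homogeneous)
    show "TT_pairing w' [q] Y = TT_pairing w [q] Y" if "q \<in> ops P n" for n q Y
      using that \<open>?S w\<close> \<open>?S w'\<close> by simp
  qed (use \<open>?S w\<close> \<open>?S w'\<close> in \<open>auto intro: letters_lists simp: TT_pairing_letters\<close>)
  ultimately have "Delta_star_T P b = w" unfolding Delta_star_T_def by (rule the_equality)
  with w show ?in ?pairing by simp_all
qed

lemma bracket_op_eq:
  assumes "lin f"
  shows "f (bracket_op P n p Y) = insertion_sum I n Y (\<lambda>zs. f (opcomp P p zs))"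
  unfolding bracket_op_def lin_sum[OF assms]
  by (rule insertion_sum_subsets[where \<Phi> = "\<lambda>zs. f (opcomp P p zs)"])

lemma Delta_prime_T:
  assumes b: "b \<in> \<B>"
  shows "Delta_prime_T P b \<in> lincomb (lists \<B> \<times> lists \<B>)" (is ?in)
    and "TT_pairing (Delta_prime_T P b) [] Y = (case Y of [y] \<Rightarrow> b y | _ \<Rightarrow> 0)" (is ?pairing0)
    and "p \<in> ops P n \<Longrightarrow> TT_pairing (Delta_prime_T P b) [p] Y
      = insertion_sum I n Y (\<lambda>zs. b (opcomp P p zs))" (is "_ \<Longrightarrow> ?pairing1")
    and "2 \<le> length X \<Longrightarrow> TT_pairing (Delta_prime_T P b) X Y = 0" (is "_ \<Longrightarrow> ?pairing2")
proof -
  let ?S = "\<lambda>w. w \<in> lincomb (lists \<B> \<times> lists \<B>) \<and>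
    (\<forall>Y. TT_pairing w [] Y = (case Y of [y] \<Rightarrow> b y | _ \<Rightarrow> 0)) \<and>
    (\<forall>n. \<forall>p\<in>ops P n. \<forall>Y. TT_pairing w [p] Y = b (bracket_op P n p Y)) \<and>
    (\<forall>X Y. 2 \<le> length X \<longrightarrow> TT_pairing w X Y = 0)"
  have lin_b: "lin b" using b by (rule dual_basis_lin)
  obtain N where N: "\<And>n x. N < n \<Longrightarrow> x \<in> ops P n \<Longrightarrow> b x = 0"
    using dual_bound[OF subsetD[OF dual_basis(1)[OF operad] b]] by metis
  obtain F where "finite F \<and> F \<subseteq> \<B> \<and> (\<forall>x. (\<forall>b\<in>F. b x = 0) \<longrightarrow> (\<forall>n\<le>N. hc n x = 0))"
    using dual_basis_detects[of N] ..
  then have F: "finite F" "F \<subseteq> \<B>" and Z: "\<And>x n. \<forall>b\<in>F. b x = 0 \<Longrightarrow> n \<le> N \<Longrightarrow> hc n x = 0"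
    by simp_all
  let ?G = "\<lambda>n p Y. insertion_sum I n Y (\<lambda>zs. b (opcomp P p zs))"
  let ?\<Psi> = "\<lambda>xs. case xs of [] \<Rightarrow> 0 | p # Y \<Rightarrow> \<Sum>n\<le>N. ?G n (hc n p) Y"
  have "\<exists>w\<in>lincomb (letters \<times> lists \<B>). \<forall>x Y. TT_pairing w [x] Y = ?\<Psi> (x # Y)"
  proof (rule TT_pairing_exists[OF F])
    show "multilin (Suc k) ?\<Psi>" for k
    proof (rule multilin_SucI)
      show "lin (\<lambda>x. ?\<Psi> (x # xs))" for xs
      proof -
        have "lin (\<lambda>x. ?G n (hc n x) xs)" for n
        proof (rule insertion_sum_lin)
          show "lin (\<lambda>x. b (opcomp P (hc n x) zs))" if "length zs = n" for zs
            using lin_opcomp_hc[OF lin_b, of zs] that by simp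
        qed
        then show ?thesis by (simp add: lin_sum_fun)
      qed
      show "multilin k (\<lambda>xs. ?\<Psi> (x # xs))" for x
        by (simp add: multilin_sum_fun insertion_sum_multilin multilin_opcomp[OF hc(1) lin_b])
    qed
    show "?\<Psi> (as @ x # bs) = 0" if x: "\<forall>b\<in>F. b x = 0" for as x bs
    proof (cases as)
      case Nil
      have "?G n (hc n x) bs = 0" if "n \<le> N" for n
        by (rule insertion_sum_eq_0) (simp add: Z[OF x that] opcomp_zero_left lin_0[OF lin_b])
      then show ?thesis using Nil by simp
    next
      case (Cons p as')
      have "?G n (hc n p) (as' @ x # bs) = 0" for n
      proof (rule insertion_sum_eq_0)
        fix zs assume zs: "length zs = n" "set (as' @ x # bs) \<subseteq> set zs"
        have "x \<in> set zs" "\<forall>n\<le>N. hc n x = 0" using zs(2) Z[OF x] by auto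
        then show "b (opcomp P (hc n p) zs) = 0"
          using zs(1) hc(1) by (intro opcomp_eq_0[OF lin_b N]) auto
      qed
      then show ?thesis using Cons by simp
    qed
    show "?\<Psi> (x # xs) = 0" if "N < length xs" for x xs
      using that by (simp add: insertion_sum_long)
  qed
  then obtain w1 where w1: "w1 \<in> lincomb (letters \<times> lists \<B>)"
    "\<And>x Y. TT_pairing w1 [x] Y = (\<Sum>n\<le>N. ?G n (hc n x) Y)" by auto
  define w where "w = w1 + Poly_Mapping.single ([], [b]) 1"
  have TT_w: "TT_pairing w X Y = TT_pairing w1 X Y + word_pairing [] X * word_pairing [b] Y" for X Y
    by (simp add: TT_pairing_ev w_def ev_add pchar_def)
  have "TT_pairing w [p] Y = b (bracket_op P n p Y)" if p: "p \<in> ops P n" for n p Y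
  proof -
    have "?G m (hc m p) Y = (if m = n then ?G n p Y else 0)" for m
      using p by (auto simp: hc_ops opcomp_zero_left lin_0[OF lin_b] intro!: insertion_sum_eq_0)
    then have "TT_pairing w [p] Y = (if n \<le> N then ?G n p Y else 0)"
      by (simp add: TT_w w1(2))
    moreover have "?G n p Y = 0" if "N < n"
      using p that by (intro insertion_sum_eq_0 opcomp_eq_0[OF lin_b N]) auto
    ultimately show ?thesis by (simp add: bracket_op_eq[OF lin_b])
  qed
  moreover have "w \<in> lincomb (lists \<B> \<times> lists \<B>)"
    unfolding w_def using w1(1) b by (intro lincomb_add lincomb_single letters_lists) auto
  moreover have "TT_pairing w [] Y = (case Y of [y] \<Rightarrow> b y | _ \<Rightarrow> 0)" for Y
    by (auto simp: TT_w TT_pairing_letters[OF w1(1)] word_pairing_length split: list.split)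
  moreover have "TT_pairing w X Y = 0" if "2 \<le> length X" for X Y
    using that by (auto simp: TT_w TT_pairing_letters[OF w1(1)])
  ultimately have "?S w" by blast
  moreover have "w' = w" if "?S w'" for w'
  proof (rule TT_pairing_eqI_homogeneous)
    show "TT_pairing w' [q] Y = TT_pairing w [q] Y" if "q \<in> ops P n" for n q Y
      using that \<open>?S w\<close> \<open>?S w'\<close> by simp
    show "TT_pairing w' X Y = TT_pairing w X Y" if "length X \<noteq> 1" for X Y
      using that \<open>?S w\<close> \<open>?S w'\<close> by (cases X) (auto simp: Suc_le_eq)
  qed (use \<open>?S w\<close> \<open>?S w'\<close> in blast)+
  ultimately have "Delta_prime_T P b = w" unfolding Delta_prime_T_def by (rule the_equality)
  with \<open>?S w\<close> show ?in ?pairing0 "p \<in> ops P n \<Longrightarrow> ?pairing1" "2 \<le> length X \<Longrightarrow> ?pairing2"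
    by (simp_all add: bracket_op_eq[OF lin_b])
qed

lemma hc_bound:
  obtains N where "\<And>n. N < n \<Longrightarrow> hc n x = 0"
proof -
  obtain N where N: "\<forall>n\<in>{n. hc n x \<noteq> 0}. n \<le> N"
    using hc(2)[of x] unfolding finite_nat_set_iff_bounded_le ..
  show ?thesis
  proof (rule that, rule ccontr)
    fix n assume "N < n" "hc n x \<noteq> 0"
    with N have "n \<le> N" by blast
    with \<open>N < n\<close> show False by simp
  qed
qed

lemma ev_Delta_star_T:
  assumes b: "b \<in> \<B>"
  shows "ev (pchar (mon x) (mon y)) (abelianize (Delta_star_T P b)) = b (pcomp x y)"
proof -
  have lin_b: "lin b" using b by (rule dual_basis_lin)
  obtain L where L: "\<And>R S. L \<le> R \<Longrightarrow> L \<le> S \<Longrightarrow>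
      ev (pchar (mon x) (mon y)) (abelianize (Delta_star_T P b))
        = (\<Sum>r\<le>R. \<Sum>s\<le>S. TT_pairing (Delta_star_T P b) (replicate r x) (replicate s y))"
    using ev_abelianize[of x y "Delta_star_T P b"] by metis
  obtain N where N: "\<And>n. N < n \<Longrightarrow> hc n x = 0" using hc_bound[of x] by metis
  define S where "S = max L N"
  have "(\<Sum>s\<le>S. TT_pairing (Delta_star_T P b) (replicate r x) (replicate s y))
      = (if r = 1 then b (pcomp x y) else 0)" for r
  proof (cases "r = 1")
    case True
    have "pcomp x y = (\<Sum>s\<le>S. opcomp P (hc s x) (replicate s y))"
      using N by (intro pcomp_superset) (auto simp: S_def)
    then show ?thesis
      using True by (simp add: Delta_star_T(2)[OF b] lin_sum[OF lin_b])
  qed (simp add: TT_pairing_letters[OF Delta_star_T(1)[OF b]])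
  then have "(\<Sum>r\<le>Suc L. \<Sum>s\<le>S. TT_pairing (Delta_star_T P b) (replicate r x) (replicate s y))
      = (\<Sum>r\<le>Suc L. if r = 1 then b (pcomp x y) else 0)"
    by simp
  with L[of "Suc L" S] show ?thesis by (simp add: S_def)
qed

text \<open>The monoid whose coordinate bialgebra is \<open>D_prime P\<close>: the translate by \<open>I\<close> of \<open>pcomp\<close>.\<close>

definition pcomp' :: "'p \<Rightarrow> 'p \<Rightarrow> 'p" where
  "pcomp' x y = pcomp (x + I) (y + I) - I"

lemma pcomp'_alt: "pcomp' x y = y + pcomp x (I + y)"
  by (simp add: pcomp'_def pcomp_add pcomp_unit_left add_ac)

lemma ev_Delta_prime_T:
  assumes b: "b \<in> \<B>"
  shows "ev (pchar (mon x) (mon y)) (abelianize (Delta_prime_T P b)) = b (pcomp' x y)"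
proof -
  let ?w = "Delta_prime_T P b"
  have lin_b: "lin b" using b by (rule dual_basis_lin)
  obtain L where L: "\<And>R S. L \<le> R \<Longrightarrow> L \<le> S \<Longrightarrow>
      ev (pchar (mon x) (mon y)) (abelianize ?w)
        = (\<Sum>r\<le>R. \<Sum>s\<le>S. TT_pairing ?w (replicate r x) (replicate s y))"
    using ev_abelianize[of x y ?w] by metis
  obtain N where N: "\<And>n. N < n \<Longrightarrow> hc n x = 0" using hc_bound[of x] by metis
  define S where "S = Suc (max L N)"
  have 0: "(\<Sum>s\<le>S. TT_pairing ?w [] (replicate s y)) = b y"
  proof -
    have "TT_pairing ?w [] (replicate s y) = (if s = 1 then b y else 0)" for s
      by (cases s; cases "s - 1") (auto simp: Delta_prime_T(2)[OF b])
    then show ?thesis by (simp add: S_def del: sum.atMost_Suc)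
  qed
  have 1: "(\<Sum>s\<le>S. TT_pairing ?w [x] (replicate s y)) = b (pcomp x (I + y))"
  proof -
    note lin_w = lin_TT_pairing[OF Delta_prime_T(1)[OF b]]
    have x: "x = (\<Sum>n\<le>N. hc n x)" using N by (intro sum_hc[symmetric]) auto
    have "TT_pairing ?w [x] (replicate s y) = (\<Sum>n\<le>N. TT_pairing ?w [hc n x] (replicate s y))" for s
      by (subst x) (rule lin_sum[OF lin_w])
    then have "(\<Sum>s\<le>S. TT_pairing ?w [x] (replicate s y))
        = (\<Sum>s\<le>S. \<Sum>n\<le>N. TT_pairing ?w [hc n x] (replicate s y))" by simp
    also have "\<dots> = (\<Sum>n\<le>N. \<Sum>s\<le>S. TT_pairing ?w [hc n x] (replicate s y))" by (rule sum.swap)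
    also have "\<dots> = (\<Sum>n\<le>N. b (opcomp P (hc n x) (replicate n (I + y))))"
    proof (intro sum.cong refl)
      fix n assume "n \<in> {..N}"
      then have "n \<le> S" by (simp add: S_def)
      then show "(\<Sum>s\<le>S. TT_pairing ?w [hc n x] (replicate s y)) = b (opcomp P (hc n x) (replicate n (I + y)))"
        unfolding Delta_prime_T(3)[OF b hc(1)]
        by (rule insertion_sum_replicate[OF multilin_opcomp[OF hc(1) lin_b]])
    qed
    also have "\<dots> = b (pcomp x (I + y))"
      using N by (subst pcomp_superset[of "{..N}"]) (auto simp: lin_sum[OF lin_b])
    finally show ?thesis .
  qed
  have "(\<Sum>s\<le>S. TT_pairing ?w (replicate r x) (replicate s y))
      = (if r = 0 then b y else 0) + (if r = 1 then b (pcomp x (I + y)) else 0)" for r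
    using 0 1 by (cases "r \<le> 1") (auto simp: le_Suc_eq Delta_prime_T(4)[OF b])
  then have "(\<Sum>r\<le>Suc L. \<Sum>s\<le>S. TT_pairing ?w (replicate r x) (replicate s y))
      = (\<Sum>r\<le>Suc L. (if r = 0 then b y else 0) + (if r = 1 then b (pcomp x (I + y)) else 0))"
    by simp
  also have "\<dots> = b y + b (pcomp x (I + y))" by (simp add: sum.distrib del: sum.atMost_Suc)
  also have "\<dots> = b (pcomp' x y)" by (simp add: pcomp'_alt lin_add[OF lin_b])
  finally show ?thesis using L[of "Suc L" S] by (simp add: S_def)
qed

lemma S_mons_eq: "S_mons P = {m. set_mset m \<subseteq> \<B>}"
  by (simp add: S_mons_def)

lemma point_bialgebra_D_star:
  "point_bialgebra \<B> (\<lambda>b. abelianize (Delta_star_T P b)) (\<lambda>b. b I) pcomp I"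
proof
  fix b assume b: "b \<in> \<B>"
  show "abelianize (Delta_star_T P b) \<in> lincomb ({m. set_mset m \<subseteq> \<B>} \<times> {m. set_mset m \<subseteq> \<B>})"
    using lincomb_abelianize[OF letters_lists[OF Delta_star_T(1)[OF b]]] by (simp add: S_mons_eq)
qed (use separating_S in \<open>simp_all add: S_mons_eq ev_Delta_star_T pcomp_assoc pcomp_unit_left pcomp_unit_right\<close>)

lemma point_bialgebra_D_prime:
  "point_bialgebra \<B> (\<lambda>b. abelianize (Delta_prime_T P b)) (\<lambda>b. 0) pcomp' 0"
proof
  fix b assume b: "b \<in> \<B>"
  show "abelianize (Delta_prime_T P b) \<in> lincomb ({m. set_mset m \<subseteq> \<B>} \<times> {m. set_mset m \<subseteq> \<B>})"
    using lincomb_abelianize[OF Delta_prime_T(1)[OF b]] by (simp add: S_mons_eq)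
  show "0 = b 0" using lin_0[OF dual_basis_lin[OF b]] by simp
qed (use separating_S in \<open>simp_all add: S_mons_eq ev_Delta_prime_T pcomp'_def pcomp_assoc pcomp_unit_left pcomp_unit_right\<close>)

lemma gen_in: "f \<in> dual P \<Longrightarrow> gen P f \<in> lincomb (S_mons P)"
  unfolding gen_def S_mons_def
  by (intro lincomb_sum lincomb_single) (auto dest: fn.representation_ne_zero)

lemma ev_gen:
  assumes "f \<in> dual P"
  shows "ev (mon x) (gen P f) = f x"
proof -
  let ?R = "fn.representation \<B> f"
  have "ev (mon x) (gen P f) = (\<Sum>b | ?R b \<noteq> 0. fscale (?R b) b) x"
    by (simp add: gen_def ev_sum sum_fun_apply fscale_def mon_def)
  also have "(\<Sum>b | ?R b \<noteq> 0. fscale (?R b) b) = f"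
    using dual_basis(2,3)[OF operad] assms by (intro fn.sum_nonzero_representation_eq) auto
  finally show ?thesis .
qed

definition translate :: "'p \<Rightarrow> (('p \<Rightarrow> 'k) multiset \<Rightarrow>\<^sub>0 'k) \<Rightarrow> (('p \<Rightarrow> 'k) multiset \<Rightarrow>\<^sub>0 'k)" where
  "translate a = alg_ext (Poly_Mapping.single 0)
    (\<lambda>b. Poly_Mapping.single {#b#} 1 + Poly_Mapping.single 0 (b a))"

lemma ev_translate_generator:
  "b \<in> \<B> \<Longrightarrow> ev (mon x) (Poly_Mapping.single {#b#} 1 + Poly_Mapping.single 0 (b a)) = b (x + a)"
  by (simp add: ev_add mon_def lin_add[OF dual_basis_lin])

lemma translate_generator_in:
  "b \<in> \<B> \<Longrightarrow> Poly_Mapping.single {#b#} 1 + Poly_Mapping.single 0 (b a) \<in> lincomb {m. set_mset m \<subseteq> \<B>}"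
  by (intro lincomb_add lincomb_single) auto

lemma translate_gen:
  assumes f: "f \<in> dual P"
  shows "translate a (gen P f) = gen P f + Poly_Mapping.single 0 (f a)"
proof (rule separatingD[OF separating_S])
  note gen = gen_in[OF f, unfolded S_mons_eq]
  show "translate a (gen P f) \<in> lincomb (S_mons P)"
    unfolding translate_def S_mons_eq
    by (rule lincomb_alg_ext[OF submonoid_mons translate_generator_in gen])
  show "gen P f + Poly_Mapping.single 0 (f a) \<in> lincomb (S_mons P)"
    by (intro lincomb_add gen_in f lincomb_single) (simp add: S_mons_def)
  fix x
  have "ev (mon x) (translate a (gen P f)) = ev (mon (x + a)) (gen P f)"
    unfolding translate_def by (rule ev_mon_alg_ext[OF gen ev_translate_generator])
  also have "\<dots> = f (x + a)" by (rule ev_gen[OF f])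
  also have "\<dots> = f x + f a" using f by (simp add: dual_iff lin_add)
  finally show "ev (mon x) (translate a (gen P f)) = ev (mon x) (gen P f + Poly_Mapping.single 0 (f a))"
    by (simp add: ev_add ev_gen[OF f] mon_def)
qed

lemma bialgebra_iso_translate: "bialgebra_iso (D_star P) (D_prime P) (translate I)"
  unfolding D_star_def D_prime_def S_mons_eq translate_def
  by (rule bialgebra_iso_points[OF point_bialgebra_D_star point_bialgebra_D_prime
        translate_generator_in ev_translate_generator translate_generator_in
        ev_translate_generator[where a = "- I"]])
    (simp_all add: pcomp'_def)

lemma bialgebra_iso_translate_uminus: "bialgebra_iso (D_prime P) (D_star P) (translate (- I))"
  unfolding D_star_def D_prime_def S_mons_eq translate_def
  by (rule bialgebra_iso_points[OF point_bialgebra_D_prime point_bialgebra_D_star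
        translate_generator_in ev_translate_generator translate_generator_in
        ev_translate_generator[where a = I]])
    (simp_all add: pcomp'_def)

lemma dual_on_dual: "f \<in> dual_on P N \<Longrightarrow> f \<in> dual P"
  by (simp add: dual_on_def)

lemma dual_on_unit: "f \<in> dual_on P {2..} \<Longrightarrow> f I = 0"
  using opunit_in by (auto simp: dual_on_def dest: spec[of _ "Suc 0"])

lemma dual_uminus: "f \<in> dual P \<Longrightarrow> f (- x) = - f x"
  using lin_diff[of f 0 x] lin_0[of f] by (simp add: dual_iff)

end

theorem corollary53:
  fixes P :: "('k::field_char_0, 'p::ab_group_add) operad_data"
  assumes "operad P"
    and "ops P 0 = {0}"
    and "\<forall>n. \<exists>B. finite B \<and> ops P n = module.span (smul P) B"
  shows "\<exists>\<phi> \<psi>.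
      bialgebra_iso (D_star P) (D_prime P) \<phi> \<and>
      (\<forall>f\<in>dual_on P {1}. \<phi> (gen P f) = gen P f + Poly_Mapping.single 0 (f (opunit P))) \<and>
      (\<forall>f\<in>dual_on P {2..}. \<phi> (gen P f) = gen P f) \<and>
      bialgebra_iso (D_prime P) (D_star P) \<psi> \<and>
      (\<forall>f\<in>dual_on P {1}. \<psi> (gen P f) = gen P f - Poly_Mapping.single 0 (f (opunit P))) \<and>
      (\<forall>f\<in>dual_on P {2..}. \<psi> (gen P f) = gen P f)"
proof -
  interpret operad P by (rule assms(1))
  interpret fin_operad P by unfold_locales (use assms(2,3) in auto)
  show ?thesis
    by (intro exI[of _ "translate (opunit P)"] exI[of _ "translate (- opunit P)"])
      (auto simp: bialgebra_iso_translate bialgebra_iso_translate_uminus translate_gen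
        dual_on_dual dual_on_unit dual_uminus single_uminus)
qed

end
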